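(* Fix the dimension $d$. Let $P\subset\mathbb{R}^d$ be a rational polytope of input bit-size $L$. There is an algorithm that computes the arithmetic width $\mathrm{aw}(P)$ in time single-exponential in $L$.
   Context: A rational polytope is the convex hull of finitely many points of $\mathbb{Q}^d$ (given by rational data of total bit-size $L$). For nonzero $c\in\mathbb{Z}^d$, $\mathrm{aw}_c(P)$ is the number of hyperplanes with normal vector $c$ that contain a point of $P\cap\mathbb{Z}^d$ (equivalently, the number of distinct values of $c^Tx$ over $x\in P\cap\mathbb{Z}^d$), and $\mathrm{aw}(P)=\min_{c\in\mathbb{Z}^d\setminus\{0\}}\mathrm{aw}_c(P)$. *)

theory Defs
  imports "HOL-Analysis.Analysis" "HOL-Library.Log_Nat"
begin

section \<open>Arithmetic width\<close>

definition lattice_points :: "(real ^ 'n) set" where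
  "lattice_points = {x. \<forall>i. x $ i \<in> \<int>}"

definition hyperplane :: "int ^ 'n \<Rightarrow> real \<Rightarrow> (real ^ 'n::finite) set" where
  "hyperplane c b = {x. (\<chi> i. real_of_int (c $ i)) \<bullet> x = b}"

text \<open>For \<open>P\<close> bounded and \<open>c \<noteq> 0\<close> the set of hyperplanes counted here is finite, so the
  convention \<open>card A = 0\<close> for infinite \<open>A\<close> plays no role.\<close>

definition aw_dir :: "int ^ 'n \<Rightarrow> (real ^ 'n::finite) set \<Rightarrow> nat" where
  "aw_dir c P = card {H. (\<exists>b. H = hyperplane c b) \<and> H \<inter> (P \<inter> lattice_points) \<noteq> {}}"

text \<open>The index set is nonempty because types are nonempty (the dimension is at least 1), so
  this infimum in \<open>nat\<close> is a minimum.\<close>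

definition aw :: "(real ^ 'n::finite) set \<Rightarrow> nat" where
  "aw P = (INF c\<in>UNIV - {0}. aw_dir c P)"


section \<open>Rational polytopes as inputs\<close>

definition rat_polytope :: "(rat ^ 'n) list \<Rightarrow> (real ^ 'n::finite) set" where
  "rat_polytope ps = convex hull ((\<lambda>p. \<chi> i. of_rat (p $ i)) ` set ps)"

text \<open>A rational number is given by numerator and denominator in lowest terms, a point by its
  coordinates in increasing order of the index type, a polytope by the number of points followed
  by the points.\<close>

definition encode_rat :: "rat \<Rightarrow> int list" where
  "encode_rat r = [fst (quotient_of r), snd (quotient_of r)]"

definition encode_point :: "rat ^ 'n::{finite,linorder} \<Rightarrow> int list" where
  "encode_point p = concat (map (\<lambda>i. encode_rat (p $ i)) (sorted_list_of_set UNIV))"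

definition encode :: "(rat ^ 'n::{finite,linorder}) list \<Rightarrow> int list" where
  "encode ps = int (length ps) # concat (map encode_point ps)"

text \<open>The bit-size of an integer is the number of its binary digits plus one bit for the sign.\<close>

definition int_bits :: "int \<Rightarrow> nat" where
  "int_bits k = 1 + nat (bitlen \<bar>k\<bar>)"

definition bit_size :: "(rat ^ 'n::{finite,linorder}) list \<Rightarrow> nat" where
  "bit_size ps = (\<Sum>k\<leftarrow>encode ps. int_bits k)"


section \<open>Algorithms and their running time\<close>

text \<open>The model of computation is a random access machine with logarithmic cost, in structured
  form. A program uses finitely many registers, addressed by constants, and an array of integers
  with random access. Every operation is charged the bit-sizes of the integers and array addresses
  it handles; multiplication is charged their product (schoolbook multiplication). The model is
  polynomially equivalent to multitape Turing machines, so the notion of time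
  \<open>2\<close> to the power \<open>O(L)\<close> is the same for both.\<close>

type_synonym state = "(nat \<Rightarrow> int) \<times> (int \<Rightarrow> int)"

datatype com =
    Skip
  | Const nat int
  | Add nat nat nat
  | Sub nat nat nat
  | Mul nat nat nat
  | Load nat nat
  | Store nat nat
  | Seq com com
  | IfPos nat com com
  | WhilePos nat com

text \<open>\<open>exec p s t s'\<close>: started in state \<open>s\<close>, program \<open>p\<close> halts in state \<open>s'\<close> at total cost \<open>t\<close>.\<close>

inductive exec :: "com \<Rightarrow> state \<Rightarrow> nat \<Rightarrow> state \<Rightarrow> bool" where
  Skip: "exec Skip s 1 s"
| Const: "exec (Const i k) (x, m) (int_bits k) (x(i := k), m)"
| Add: "exec (Add i j k) (x, m) (int_bits (x j) + int_bits (x k)) (x(i := x j + x k), m)"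
| Sub: "exec (Sub i j k) (x, m) (int_bits (x j) + int_bits (x k)) (x(i := x j - x k), m)"
| Mul: "exec (Mul i j k) (x, m) (int_bits (x j) * int_bits (x k)) (x(i := x j * x k), m)"
| Load: "exec (Load i j) (x, m) (int_bits (x j) + int_bits (m (x j))) (x(i := m (x j)), m)"
| Store: "exec (Store i j) (x, m) (int_bits (x i) + int_bits (x j)) (x, m(x i := x j))"
| Seq: "exec p s t s' \<Longrightarrow> exec q s' u s'' \<Longrightarrow> exec (Seq p q) s (t + u) s''"
| IfPos_True: "fst s i > 0 \<Longrightarrow> exec p s t s' \<Longrightarrow>
    exec (IfPos i p q) s (int_bits (fst s i) + t) s'"
| IfPos_False: "\<not> fst s i > 0 \<Longrightarrow> exec q s t s' \<Longrightarrow>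
    exec (IfPos i p q) s (int_bits (fst s i) + t) s'"
| WhilePos_False: "\<not> fst s i > 0 \<Longrightarrow> exec (WhilePos i p) s (int_bits (fst s i)) s"
| WhilePos_True: "fst s i > 0 \<Longrightarrow> exec p s t s' \<Longrightarrow> exec (WhilePos i p) s' u s'' \<Longrightarrow>
    exec (WhilePos i p) s (int_bits (fst s i) + t + u) s''"

inductive_cases exec_SkipE: "exec Skip s t s'"
inductive_cases exec_ConstE: "exec (Const i k) s t s'"
inductive_cases exec_AddE: "exec (Add i j k) s t s'"
inductive_cases exec_SubE: "exec (Sub i j k) s t s'"
inductive_cases exec_MulE: "exec (Mul i j k) s t s'"
inductive_cases exec_LoadE: "exec (Load i j) s t s'"
inductive_cases exec_StoreE: "exec (Store i j) s t s'"
inductive_cases exec_SeqE: "exec (Seq p q) s t s'"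
inductive_cases exec_IfPosE: "exec (IfPos i p q) s t s'"
inductive_cases exec_WhilePosE: "exec (WhilePos i p) s t s'"

text \<open>Programs are deterministic, so it suffices to ask for some halting execution below.\<close>

lemma exec_deterministic:
  "exec p s t s' \<Longrightarrow> exec p s u s'' \<Longrightarrow> u = t \<and> s'' = s'"
proof (induction arbitrary: u s'' rule: exec.induct)
  case (Seq p s t s' q u s'')
  from Seq.prems show ?case by (rule exec_SeqE) (use Seq.IH in blast)
next
  case (IfPos_True s i p t s' q)
  from IfPos_True.prems show ?case by (rule exec_IfPosE) (use IfPos_True.hyps IfPos_True.IH in blast)+
next
  case (IfPos_False s i q t s' p)
  from IfPos_False.prems show ?case by (rule exec_IfPosE) (use IfPos_False.hyps IfPos_False.IH in blast)+
next
  case (WhilePos_False s i p)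
  from WhilePos_False.prems show ?case by (rule exec_WhilePosE) (use WhilePos_False.hyps in blast)+
next
  case (WhilePos_True s i p t s' u s'')
  from WhilePos_True.prems show ?case
    by (rule exec_WhilePosE) (use WhilePos_True.hyps WhilePos_True.IH in blast)+
qed (auto elim: exec_SkipE exec_ConstE exec_AddE exec_SubE exec_MulE exec_LoadE exec_StoreE)

text \<open>Initially the input occupies the array cells from address 0 on, and all other cells and all
  registers are 0. The output is the final value of register 0.\<close>

definition initial_state :: "int list \<Rightarrow> state" where
  "initial_state xs =
    ((\<lambda>_. 0), (\<lambda>a. if 0 \<le> a \<and> a < int (length xs) then xs ! nat a else 0))"

definition computes_in_time ::
    "com \<Rightarrow> ('a \<Rightarrow> int list) \<Rightarrow> ('a \<Rightarrow> int) \<Rightarrow> ('a \<Rightarrow> nat) \<Rightarrow> bool" where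
  "computes_in_time p enc f T \<longleftrightarrow>
    (\<forall>a. \<exists>t s. exec p (initial_state (enc a)) t s \<and> fst s 0 = f a \<and> t \<le> T a)"

end

theory Submission
  imports Defs
begin

text \<open>Time polynomial in a number \<open>B \<le> 2\<^sup>L\<close> that exceeds all input numbers is single-exponential in \<open>L\<close>,
  and functions built from memory access by ring operations, sign tests and bounded summation are
  computable in such time, since they have polynomially bounded values. The arithmetic width has this
  form. By Siegel's lemma an optimal direction can be replaced by one with entries polynomial in \<open>B\<close>,
  because only its orthogonality to the differences of certain lattice points of \<open>P\<close> matters. Membership
  of a lattice point in \<open>P\<close> is decided by searching for a separating functional; Siegel's lemma, applied
  to the tight constraints of a well-chosen functional, shows that a separating functional also exists
  with entries polynomial in \<open>B\<close>. As the dimension is fixed, all these vectors can be enumerated.\<close>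


section \<open>Polynomially bounded functions\<close>

text \<open>Budgets are polynomials in the values rather than in their bit-sizes. This allows loops
  that count through an interval one by one, and since polynomials compose, such loops can be
  nested; the nesting depth depends on the dimension only. All programs built here leave the array
  unchanged, so the bound \<open>B\<close> on its cells persists. The obstacle on the geometric side
  is that Siegel's lemma solves homogeneous equations, whereas separation is a system of strict
  inequalities. They are scaled to \<open>1 \<le> a \<bullet> w\<close>, replaced by the equations
  that hold on a minimal face, and these are made homogeneous by an extra unknown for the right-hand
  side. The minimum over directions is itself turned into a sum: it is the number of
  \<open>k \<ge> 0\<close> below the count of every small direction.\<close>

definition poly_bounded :: "(nat \<Rightarrow> nat) \<Rightarrow> bool" where
  "poly_bounded g \<longleftrightarrow> (\<exists>K. \<forall>B\<ge>2. g B \<le> B ^ K)"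

lemma poly_bounded_const: "poly_bounded (\<lambda>_. c)"
  unfolding poly_bounded_def
proof (intro exI allI impI)
  fix B :: nat assume "2 \<le> B"
  have "c \<le> 2 ^ c" by (simp add: less_imp_le)
  also have "\<dots> \<le> B ^ c" using \<open>2 \<le> B\<close> by (rule power_mono) simp
  finally show "c \<le> B ^ c" .
qed

lemma poly_bounded_id: "poly_bounded (\<lambda>B. B)"
  unfolding poly_bounded_def by (rule exI[of _ 1]) simp

lemma poly_bounded_add:
  assumes "poly_bounded f" "poly_bounded g"
  shows "poly_bounded (\<lambda>B. f B + g B)"
proof -
  obtain K L where K: "\<And>B. 2 \<le> B \<Longrightarrow> f B \<le> B ^ K" and L: "\<And>B. 2 \<le> B \<Longrightarrow> g B \<le> B ^ L"
    using assms unfolding poly_bounded_def by blast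
  have "f B + g B \<le> B ^ Suc (K + L)" if B: "2 \<le> B" for B
  proof -
    have "B ^ K \<le> B ^ (K + L)" "B ^ L \<le> B ^ (K + L)" using B by (auto intro: power_increasing)
    then have "f B + g B \<le> 2 * B ^ (K + L)" using K[OF B] L[OF B] by linarith
    also have "\<dots> \<le> B * B ^ (K + L)" using B by simp
    finally show ?thesis by simp
  qed
  then show ?thesis unfolding poly_bounded_def by blast
qed

lemma poly_bounded_mult:
  assumes "poly_bounded f" "poly_bounded g"
  shows "poly_bounded (\<lambda>B. f B * g B)"
proof -
  obtain K L where K: "\<And>B. 2 \<le> B \<Longrightarrow> f B \<le> B ^ K" and L: "\<And>B. 2 \<le> B \<Longrightarrow> g B \<le> B ^ L"
    using assms unfolding poly_bounded_def by blast
  have "f B * g B \<le> B ^ (K + L)" if B: "2 \<le> B" for B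
    using mult_mono[OF K[OF B] L[OF B]] by (simp add: power_add)
  then show ?thesis unfolding poly_bounded_def by blast
qed

text \<open>A summation variable can exceed \<open>B\<close>, so a loop body is evaluated under a
  larger bound on its arguments. Composition keeps its cost polynomial in \<open>B\<close>.\<close>

lemma poly_bounded_compose:
  assumes "poly_bounded f" "poly_bounded g" "\<And>B. 2 \<le> B \<Longrightarrow> 2 \<le> g B"
  shows "poly_bounded (\<lambda>B. f (g B))"
proof -
  obtain K L where K: "\<And>B. 2 \<le> B \<Longrightarrow> f B \<le> B ^ K" and L: "\<And>B. 2 \<le> B \<Longrightarrow> g B \<le> B ^ L"
    using assms unfolding poly_bounded_def by blast
  have "f (g B) \<le> B ^ (L * K)" if B: "2 \<le> B" for B
    using K[OF assms(3)[OF B]] power_mono[OF L[OF B], of K] by (simp add: power_mult)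
  then show ?thesis unfolding poly_bounded_def by blast
qed

lemmas poly_bounded_intros =
  poly_bounded_const poly_bounded_id poly_bounded_add poly_bounded_mult


section \<open>Executions with an upper bound on the time\<close>

lemma int_bits_le: "int_bits k \<le> nat \<bar>k\<bar> + 1"
proof (cases "k = 0")
  case False
  then have "2 ^ nat (bitlen \<bar>k\<bar> - 1) \<le> \<bar>k\<bar>" using bitlen_bounds[of "\<bar>k\<bar>"] by simp
  moreover have "int (nat (bitlen \<bar>k\<bar> - 1)) < 2 ^ nat (bitlen \<bar>k\<bar> - 1)"
    using less_exp[of "nat (bitlen \<bar>k\<bar> - 1)"] by (metis of_nat_less_iff of_nat_numeral of_nat_power)
  ultimately have "bitlen \<bar>k\<bar> \<le> \<bar>k\<bar>" by linarith
  then show ?thesis by (simp add: int_bits_def)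
qed (simp add: int_bits_def)

definition runs :: "com \<Rightarrow> state \<Rightarrow> nat \<Rightarrow> state \<Rightarrow> bool" where
  "runs p s T s' \<longleftrightarrow> (\<exists>t\<le>T. exec p s t s')"

lemma runs_mono: "runs p s T s' \<Longrightarrow> T \<le> U \<Longrightarrow> runs p s U s'"
  unfolding runs_def by (meson order_trans)

lemma runs_Const: "runs (Const i k) (x, m) (nat \<bar>k\<bar> + 1) (x(i := k), m)"
  unfolding runs_def using exec.Const int_bits_le by blast

lemma runs_Add: "runs (Add i j k) (x, m) (nat \<bar>x j\<bar> + nat \<bar>x k\<bar> + 2) (x(i := x j + x k), m)"
  unfolding runs_def
  by (rule exI, rule conjI[OF _ exec.Add]) (use int_bits_le[of "x j"] int_bits_le[of "x k"] in linarith)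

lemma runs_Sub: "runs (Sub i j k) (x, m) (nat \<bar>x j\<bar> + nat \<bar>x k\<bar> + 2) (x(i := x j - x k), m)"
  unfolding runs_def
  by (rule exI, rule conjI[OF _ exec.Sub]) (use int_bits_le[of "x j"] int_bits_le[of "x k"] in linarith)

lemma runs_Mul: "runs (Mul i j k) (x, m) ((nat \<bar>x j\<bar> + 1) * (nat \<bar>x k\<bar> + 1)) (x(i := x j * x k), m)"
  unfolding runs_def using exec.Mul mult_mono[OF int_bits_le int_bits_le] by blast

lemma runs_Load: "runs (Load i j) (x, m) (nat \<bar>x j\<bar> + nat \<bar>m (x j)\<bar> + 2) (x(i := m (x j)), m)"
  unfolding runs_def
  by (rule exI, rule conjI[OF _ exec.Load]) (use int_bits_le[of "x j"] int_bits_le[of "m (x j)"] in linarith)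

lemma runs_Seq: "runs p s T s' \<Longrightarrow> runs q s' U s'' \<Longrightarrow> runs (Seq p q) s (T + U) s''"
  unfolding runs_def by (meson add_mono exec.Seq)

lemma runs_IfPos:
  assumes "x i > 0 \<Longrightarrow> runs p (x, m) T s'" "\<not> x i > 0 \<Longrightarrow> runs q (x, m) T s'"
  shows "runs (IfPos i p q) (x, m) (nat \<bar>x i\<bar> + 1 + T) s'"
proof (cases "x i > 0")
  case True
  then obtain t where "t \<le> T" "exec p (x, m) t s'" using assms(1) unfolding runs_def by blast
  then show ?thesis unfolding runs_def
    using exec.IfPos_True[of "(x, m)" i p t s' q] True int_bits_le[of "x i"]
    by (intro exI[of _ "int_bits (x i) + t"]) auto
next
  case False
  then obtain t where "t \<le> T" "exec q (x, m) t s'" using assms(2) unfolding runs_def by blast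
  then show ?thesis unfolding runs_def
    using exec.IfPos_False[of "(x, m)" i q t s' p] False int_bits_le[of "x i"]
    by (intro exI[of _ "int_bits (x i) + t"]) auto
qed

lemma runs_WhilePos_False:
  assumes "\<not> x i > 0"
  shows "runs (WhilePos i p) (x, m) (nat \<bar>x i\<bar> + 1) (x, m)"
  unfolding runs_def using exec.WhilePos_False[of "(x, m)" i p] assms int_bits_le[of "x i"] by auto

lemma runs_WhilePos_True:
  assumes "x i > 0" "runs p (x, m) T s'" "runs (WhilePos i p) s' U s''"
  shows "runs (WhilePos i p) (x, m) (nat \<bar>x i\<bar> + 1 + T + U) s''"
proof -
  obtain t u where "t \<le> T" "exec p (x, m) t s'" "u \<le> U" "exec (WhilePos i p) s' u s''"
    using assms unfolding runs_def by blast
  then show ?thesis unfolding runs_def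
    using exec.WhilePos_True[of "(x, m)" i p t s' u s''] assms(1) int_bits_le[of "x i"]
    by (intro exI[of _ "int_bits (x i) + t + u"]) auto
qed

section \<open>Feasible functions of registers and memory\<close>

type_synonym 'a valuation = "(nat \<Rightarrow> int) \<Rightarrow> (int \<Rightarrow> int) \<Rightarrow> 'a"

text \<open>The arguments of the function are the registers below \<open>N\<close>, and the program may use the registers
  from \<open>r\<close> on as scratch space. Value and running time are bounded in terms of a bound \<open>B\<close> on the
  arguments and the memory cells, not of their bit-sizes.\<close>

definition evaluates :: "nat \<Rightarrow> int valuation \<Rightarrow> (nat \<Rightarrow> nat) \<Rightarrow> nat \<Rightarrow> com \<Rightarrow> bool" where
  "evaluates N f g r p \<longleftrightarrow> (\<forall>\<rho> m B. 2 \<le> B \<longrightarrow> (\<forall>i<N. nat \<bar>\<rho> i\<bar> \<le> B) \<longrightarrow> (\<forall>a. nat \<bar>m a\<bar> \<le> B) \<longrightarrow>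
    nat \<bar>f \<rho> m\<bar> \<le> g B \<and>
    (\<exists>\<rho>'. runs p (\<rho>, m) (g B) (\<rho>', m) \<and> \<rho>' r = f \<rho> m \<and> (\<forall>i<r. \<rho>' i = \<rho> i)))"

text \<open>A program that runs after another one finds changed scratch registers. Dependence on the
  registers below \<open>N\<close> ensures that it still computes the value belonging to the
  original registers.\<close>

definition depends_below :: "nat \<Rightarrow> 'a valuation \<Rightarrow> bool" where
  "depends_below N f \<longleftrightarrow> (\<forall>\<rho> \<rho>' m. (\<forall>i<N. \<rho> i = \<rho>' i) \<longrightarrow> f \<rho> m = f \<rho>' m)"

text \<open>The quantifiers over \<open>N'\<close> and \<open>r\<close> make programs relocatable:
  two functions can share one window of arguments, and scratch space can be moved above intermediate
  results. The bound \<open>g\<close> is fixed beforehand and holds for every placement.\<close>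

definition feasible :: "int valuation \<Rightarrow> bool" where
  "feasible f \<longleftrightarrow> (\<exists>N g. poly_bounded g \<and>
    (\<forall>N'\<ge>N. depends_below N' f \<and> (\<forall>r\<ge>N'. \<exists>p. evaluates N' f g r p)))"

lemma evaluatesI:
  assumes "\<And>\<rho> m B. \<lbrakk>2 \<le> B; \<And>i. i < N \<Longrightarrow> nat \<bar>\<rho> i\<bar> \<le> B; \<And>a. nat \<bar>m a\<bar> \<le> B\<rbrakk> \<Longrightarrow> nat \<bar>f \<rho> m\<bar> \<le> g B"
    and "\<And>\<rho> m B. \<lbrakk>2 \<le> B; \<And>i. i < N \<Longrightarrow> nat \<bar>\<rho> i\<bar> \<le> B; \<And>a. nat \<bar>m a\<bar> \<le> B\<rbrakk> \<Longrightarrow>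
      \<exists>\<rho>'. runs p (\<rho>, m) (g B) (\<rho>', m) \<and> \<rho>' r = f \<rho> m \<and> (\<forall>i<r. \<rho>' i = \<rho> i)"
  shows "evaluates N f g r p"
  using assms unfolding evaluates_def by blast

lemma evaluatesD:
  assumes "evaluates N f g r p" "2 \<le> B" "\<And>i. i < N \<Longrightarrow> nat \<bar>\<rho> i\<bar> \<le> B" "\<And>a. nat \<bar>m a\<bar> \<le> B"
  shows "nat \<bar>f \<rho> m\<bar> \<le> g B"
    and "\<exists>\<rho>'. runs p (\<rho>, m) (g B) (\<rho>', m) \<and> \<rho>' r = f \<rho> m \<and> (\<forall>i<r. \<rho>' i = \<rho> i)"
  using assms unfolding evaluates_def by blast+

lemma depends_belowD: "depends_below N f \<Longrightarrow> (\<And>i. i < N \<Longrightarrow> \<rho> i = \<rho>' i) \<Longrightarrow> f \<rho> m = f \<rho>' m"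
  unfolding depends_below_def by blast

lemma feasibleI:
  assumes "poly_bounded g" "\<And>N'. N \<le> N' \<Longrightarrow> depends_below N' f"
    "\<And>N' r. N \<le> N' \<Longrightarrow> N' \<le> r \<Longrightarrow> \<exists>p. evaluates N' f g r p"
  shows "feasible f"
  using assms unfolding feasible_def by blast

lemma feasibleE:
  assumes "feasible f"
  obtains g N where "poly_bounded g" "\<And>N'. N \<le> N' \<Longrightarrow> depends_below N' f"
    "\<And>N' r. N \<le> N' \<Longrightarrow> N' \<le> r \<Longrightarrow> \<exists>p. evaluates N' f g r p"
  using assms unfolding feasible_def by blast

section \<open>Constants, registers, arithmetic, memory access and sign tests\<close>

lemma feasible_const: "feasible (\<lambda>_ _. k)"
proof (rule feasibleI[of "\<lambda>B. nat \<bar>k\<bar> + 1" 0])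
  fix N' r :: nat
  show "\<exists>p. evaluates N' (\<lambda>_ _. k) (\<lambda>B. nat \<bar>k\<bar> + 1) r p"
    by (rule exI[of _ "Const r k"], rule evaluatesI)
      (auto intro!: exI[of _ "_(r := k)"] runs_Const[unfolded One_nat_def add_Suc_right add_0_right])
qed (auto simp: depends_below_def intro: poly_bounded_intros)

lemma feasible_reg: "feasible (\<lambda>\<rho> _. \<rho> i)"
proof (rule feasibleI[of "\<lambda>B. B + 3" "Suc i"])
  fix N' r :: nat assume N: "Suc i \<le> N'" "N' \<le> r"
  show "\<exists>p. evaluates N' (\<lambda>\<rho> _. \<rho> i) (\<lambda>B. B + 3) r p"
  \<comment> \<open>A register is copied by adding a zero, which the target register itself
    supplies.\<close>
  proof (rule exI[of _ "Seq (Const r 0) (Add r i r)"], rule evaluatesI)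
    fix \<rho> and m :: "int \<Rightarrow> int" and B :: nat
    assume "\<And>i. i < N' \<Longrightarrow> nat \<bar>\<rho> i\<bar> \<le> B"
    then have B: "nat \<bar>\<rho> i\<bar> \<le> B" using N by simp
    then show "nat \<bar>\<rho> i\<bar> \<le> B + 3" by simp
    have "runs (Seq (Const r 0) (Add r i r)) (\<rho>, m) (B + 3) (\<rho>(r := 0, r := \<rho> i), m)"
      using runs_Seq[OF runs_Const[of r 0 \<rho> m] runs_Add[of r i r "\<rho>(r := 0)" m]] B N
      by (auto elim!: runs_mono)
    then show "\<exists>\<rho>'. runs (Seq (Const r 0) (Add r i r)) (\<rho>, m) (B + 3) (\<rho>', m) \<and> \<rho>' r = \<rho> i \<and>
        (\<forall>i<r. \<rho>' i = \<rho> i)"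
      by (intro exI[of _ "\<rho>(r := 0, r := \<rho> i)"]) auto
  qed
qed (auto simp: depends_below_def intro: poly_bounded_intros)

text \<open>The budget \<open>(|a| + 1) * (|b| + 1) + 1\<close> covers all three arithmetic
  instructions; its last \<open>+ 1\<close> is for addition and subtraction, whose budget is
  \<open>|a| + |b| + 2\<close> even if \<open>a * b = 0\<close>. The second program works from
  \<open>Suc r\<close> on, so the first value survives in \<open>r\<close>.\<close>

lemma feasible_binary:
  assumes ins: "\<And>i j k x m. runs (ins i j k) (x, m) ((nat \<bar>x j\<bar> + 1) * (nat \<bar>x k\<bar> + 1) + 1)
      (x(i := h (x j) (x k)), m)"
    and h: "\<And>a b. nat \<bar>h a b\<bar> \<le> (nat \<bar>a\<bar> + 1) * (nat \<bar>b\<bar> + 1) + 1"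
    and f: "feasible f1" "feasible f2"
  shows "feasible (\<lambda>\<rho> m. h (f1 \<rho> m) (f2 \<rho> m))"
proof -
  from f(1) obtain g1 N1 where 1: "poly_bounded g1" "\<And>N'. N1 \<le> N' \<Longrightarrow> depends_below N' f1"
    "\<And>N' r. N1 \<le> N' \<Longrightarrow> N' \<le> r \<Longrightarrow> \<exists>p. evaluates N' f1 g1 r p"
    by (rule feasibleE) blast
  from f(2) obtain g2 N2 where 2: "poly_bounded g2" "\<And>N'. N2 \<le> N' \<Longrightarrow> depends_below N' f2"
    "\<And>N' r. N2 \<le> N' \<Longrightarrow> N' \<le> r \<Longrightarrow> \<exists>p. evaluates N' f2 g2 r p"
    by (rule feasibleE) blast
  let ?g = "\<lambda>B. g1 B + g2 B + ((g1 B + 1) * (g2 B + 1) + 1)"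
  show ?thesis
  proof (rule feasibleI[of ?g "max N1 N2"])
    show "poly_bounded ?g" by (intro poly_bounded_intros 1 2)
    fix N' assume N: "max N1 N2 \<le> N'"
    then show "depends_below N' (\<lambda>\<rho> m. h (f1 \<rho> m) (f2 \<rho> m))"
      using 1(2) 2(2) unfolding depends_below_def by (metis max.bounded_iff)
    fix r assume r: "N' \<le> r"
    obtain p1 p2 where p: "evaluates N' f1 g1 r p1" "evaluates N' f2 g2 (Suc r) p2"
      using 1(3) 2(3) N r by (meson le_SucI max.bounded_iff)
    show "\<exists>p. evaluates N' (\<lambda>\<rho> m. h (f1 \<rho> m) (f2 \<rho> m)) ?g r p"
    proof (rule exI[of _ "Seq (Seq p1 p2) (ins r r (Suc r))"], rule evaluatesI)
      fix \<rho> and m :: "int \<Rightarrow> int" and B :: nat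
      assume B: "2 \<le> B" "\<And>i. i < N' \<Longrightarrow> nat \<bar>\<rho> i\<bar> \<le> B" "\<And>a. nat \<bar>m a\<bar> \<le> B"
      have v: "nat \<bar>f1 \<rho> m\<bar> \<le> g1 B" "nat \<bar>f2 \<rho> m\<bar> \<le> g2 B"
        using evaluatesD(1)[where \<rho> = \<rho> and m = m, OF p(1) B]
          evaluatesD(1)[where \<rho> = \<rho> and m = m, OF p(2) B] by auto
      have prod: "(nat \<bar>f1 \<rho> m\<bar> + 1) * (nat \<bar>f2 \<rho> m\<bar> + 1) \<le> (g1 B + 1) * (g2 B + 1)"
        using v by (intro mult_mono) auto
      then show "nat \<bar>h (f1 \<rho> m) (f2 \<rho> m)\<bar> \<le> ?g B" using h[of "f1 \<rho> m" "f2 \<rho> m"] by linarith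
      obtain \<rho>1 where \<rho>1: "runs p1 (\<rho>, m) (g1 B) (\<rho>1, m)" "\<rho>1 r = f1 \<rho> m" "\<forall>i<r. \<rho>1 i = \<rho> i"
        using evaluatesD(2)[where \<rho> = \<rho> and m = m, OF p(1) B] by blast
      have "\<And>i. i < N' \<Longrightarrow> nat \<bar>\<rho>1 i\<bar> \<le> B" using B(2) \<rho>1(3) r by simp
      from evaluatesD(2)[where \<rho> = \<rho>1 and m = m, OF p(2) B(1) this B(3)] obtain \<rho>2
        where \<rho>2: "runs p2 (\<rho>1, m) (g2 B) (\<rho>2, m)" "\<rho>2 (Suc r) = f2 \<rho>1 m" "\<forall>i<Suc r. \<rho>2 i = \<rho>1 i"
        by blast
      have f2: "f2 \<rho>1 m = f2 \<rho> m"
        by (rule depends_belowD[OF 2(2)[of N']]) (use N r \<rho>1(3) in auto)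
      have "runs (Seq (Seq p1 p2) (ins r r (Suc r))) (\<rho>, m) (?g B) (\<rho>2(r := h (f1 \<rho> m) (f2 \<rho> m)), m)"
        using runs_Seq[OF runs_Seq[OF \<rho>1(1) \<rho>2(1)] ins[of r r "Suc r" \<rho>2 m]] \<rho>2 \<rho>1 f2 prod
        by (auto elim!: runs_mono)
      then show "\<exists>\<rho>'. runs (Seq (Seq p1 p2) (ins r r (Suc r))) (\<rho>, m) (?g B) (\<rho>', m) \<and>
          \<rho>' r = h (f1 \<rho> m) (f2 \<rho> m) \<and> (\<forall>i<r. \<rho>' i = \<rho> i)"
        by (intro exI[of _ "\<rho>2(r := h (f1 \<rho> m) (f2 \<rho> m))"]) (use \<rho>1 \<rho>2 in auto)
    qed
  qed
qed

lemma feasible_add: "feasible f1 \<Longrightarrow> feasible f2 \<Longrightarrow> feasible (\<lambda>\<rho> m. f1 \<rho> m + f2 \<rho> m)"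
  by (rule feasible_binary[where ins = Add])
    (auto intro: runs_mono[OF runs_Add] simp: algebra_simps nat_le_iff zero_le_mult_iff intro: order_trans[OF abs_triangle_ineq])

lemma feasible_diff: "feasible f1 \<Longrightarrow> feasible f2 \<Longrightarrow> feasible (\<lambda>\<rho> m. f1 \<rho> m - f2 \<rho> m)"
  by (rule feasible_binary[where ins = Sub])
    (auto intro: runs_mono[OF runs_Sub] simp: algebra_simps nat_le_iff zero_le_mult_iff intro: order_trans[OF abs_triangle_ineq4])

lemma feasible_uminus: "feasible f \<Longrightarrow> feasible (\<lambda>\<rho> m. - f \<rho> m)"
  using feasible_diff[OF feasible_const[of 0]] by simp

lemma feasible_mult: "feasible f1 \<Longrightarrow> feasible f2 \<Longrightarrow> feasible (\<lambda>\<rho> m. f1 \<rho> m * f2 \<rho> m)"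
  by (rule feasible_binary[where ins = Mul])
    (auto intro: runs_mono[OF runs_Mul] simp: algebra_simps abs_mult nat_mult_distrib)

text \<open>Shared by memory access and the sign test. In the time budget \<open>B\<close> pays for
  the loaded cell and \<open>3\<close> for the branch with its constant; the \<open>+ 1\<close> in
  the bound on the value is for truth values, as \<open>B\<close> may be \<open>0\<close>
  here.\<close>

lemma feasible_unary:
  assumes q: "\<And>r x m B. (\<And>a. nat \<bar>m a\<bar> \<le> B) \<Longrightarrow>
      runs (q r) (x, m) (nat \<bar>x r\<bar> + B + 3) (x(r := h (x r) m), m) \<and> nat \<bar>h (x r) m\<bar> \<le> B + 1"
    and f: "feasible f"
  shows "feasible (\<lambda>\<rho> m. h (f \<rho> m) m)"
proof -
  from f obtain g N where 1: "poly_bounded g" "\<And>N'. N \<le> N' \<Longrightarrow> depends_below N' f"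
    "\<And>N' r. N \<le> N' \<Longrightarrow> N' \<le> r \<Longrightarrow> \<exists>p. evaluates N' f g r p"
    by (rule feasibleE) blast
  let ?g = "\<lambda>B. g B + (g B + B + 3)"
  show ?thesis
  proof (rule feasibleI[of ?g N])
    show "poly_bounded ?g" by (intro poly_bounded_intros 1)
    fix N' assume N: "N \<le> N'"
    then show "depends_below N' (\<lambda>\<rho> m. h (f \<rho> m) m)"
      using 1(2) unfolding depends_below_def by metis
    fix r assume r: "N' \<le> r"
    obtain p where p: "evaluates N' f g r p" using 1(3) N r by blast
    show "\<exists>p. evaluates N' (\<lambda>\<rho> m. h (f \<rho> m) m) ?g r p"
    proof (rule exI[of _ "Seq p (q r)"], rule evaluatesI)
      fix \<rho> and m :: "int \<Rightarrow> int" and B :: nat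
      assume B: "2 \<le> B" "\<And>i. i < N' \<Longrightarrow> nat \<bar>\<rho> i\<bar> \<le> B" "\<And>a. nat \<bar>m a\<bar> \<le> B"
      obtain \<rho>1 where \<rho>1: "runs p (\<rho>, m) (g B) (\<rho>1, m)" "\<rho>1 r = f \<rho> m" "\<forall>i<r. \<rho>1 i = \<rho> i"
        using evaluatesD(2)[where \<rho> = \<rho> and m = m, OF p(1) B] by blast
      have q': "runs (q r) (\<rho>1, m) (nat \<bar>\<rho>1 r\<bar> + B + 3) (\<rho>1(r := h (\<rho>1 r) m), m)"
        "nat \<bar>h (\<rho>1 r) m\<bar> \<le> B + 1"
        using q B(3) by auto
      then show "nat \<bar>h (f \<rho> m) m\<bar> \<le> ?g B" using \<rho>1 by simp
      have "runs (Seq p (q r)) (\<rho>, m) (?g B) (\<rho>1(r := h (f \<rho> m) m), m)"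
        using runs_Seq[OF \<rho>1(1) q'(1)] \<rho>1 evaluatesD(1)[where \<rho> = \<rho> and m = m, OF p(1) B]
        by (auto elim!: runs_mono)
      then show "\<exists>\<rho>'. runs (Seq p (q r)) (\<rho>, m) (?g B) (\<rho>', m) \<and>
          \<rho>' r = h (f \<rho> m) m \<and> (\<forall>i<r. \<rho>' i = \<rho> i)"
        by (intro exI[of _ "\<rho>1(r := h (f \<rho> m) m)"]) (use \<rho>1 in auto)
    qed
  qed
qed

lemma feasible_load: "feasible f \<Longrightarrow> feasible (\<lambda>\<rho> m. m (f \<rho> m))"
proof (rule feasible_unary[where q = "\<lambda>r. Load r r" and h = "\<lambda>a m. m a"])
  fix r x B and m :: "int \<Rightarrow> int" assume "\<And>a. nat \<bar>m a\<bar> \<le> B"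
  from this[of "x r"] show "runs (Load r r) (x, m) (nat \<bar>x r\<bar> + B + 3) (x(r := m (x r)), m) \<and> nat \<bar>m (x r)\<bar> \<le> B + 1"
    using runs_Load[of r r x m] by (auto elim!: runs_mono intro: le_SucI)
qed

lemma feasible_pos: "feasible f \<Longrightarrow> feasible (\<lambda>\<rho> m. of_bool (f \<rho> m > 0))"
proof (rule feasible_unary[where q = "\<lambda>r. IfPos r (Const r 1) (Const r 0)" and h = "\<lambda>a m. of_bool (a > 0)"])
  fix r :: nat and x B and m :: "int \<Rightarrow> int" assume "\<And>a. nat \<bar>m a\<bar> \<le> B"
  have "runs (IfPos r (Const r 1) (Const r 0)) (x, m) (nat \<bar>x r\<bar> + 1 + 2) (x(r := of_bool (x r > 0)), m)"
    using runs_Const[of r 1 x m] runs_Const[of r 0 x m]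
    by (intro runs_IfPos) (auto elim!: runs_mono)
  then show "runs (IfPos r (Const r 1) (Const r 0)) (x, m) (nat \<bar>x r\<bar> + B + 3) (x(r := of_bool (x r > 0)), m)
      \<and> nat \<bar>of_bool (x r > 0) :: int\<bar> \<le> B + 1"
    by (auto elim!: runs_mono)
qed

text \<open>The hypotheses on \<open>B\<close> and \<open>X\<close> are loop invariants: they bound
  the current variable plus the remaining rounds, and the current sum plus all that can still be
  added. A round costs at most \<open>B + 1\<close> for the test, \<open>G\<close> for the body,
  \<open>X + G + 2\<close> for adding to the sum, \<open>2\<close> for the constant and
  \<open>B + 3\<close> for each of the two counters; the final \<open>1\<close> is the failing
  test.\<close>

lemma runs_sum_loop:
  fixes f :: "int valuation" and r v :: nat and p :: com
  defines "w \<equiv> WhilePos r (Seq p (Seq (Add (r+3) (r+3) (r+4)) (Seq (Const (r+4) 1)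
    (Seq (Add v v (r+4)) (Sub r r (r+4))))))"
  assumes p: "\<And>\<rho>. (\<And>i. i < N \<Longrightarrow> nat \<bar>\<rho> i\<bar> \<le> B) \<Longrightarrow> nat \<bar>f \<rho> m\<bar> \<le> G \<and>
      (\<exists>\<rho>'. runs p (\<rho>, m) G (\<rho>', m) \<and> \<rho>' (r+4) = f \<rho> m \<and> (\<forall>i<r+4. \<rho>' i = \<rho> i))"
    and f: "depends_below N f" and N: "v < N" "N \<le> r"
  shows "\<lbrakk>\<rho> r = int j; \<And>i. i < N \<Longrightarrow> i \<noteq> v \<Longrightarrow> nat \<bar>\<rho> i\<bar> \<le> B; nat \<bar>\<rho> v\<bar> + j \<le> B; nat \<bar>\<rho> (r+3)\<bar> + j * G \<le> X\<rbrakk> \<Longrightarrow>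
    \<exists>\<rho>'. runs w (\<rho>, m) (j * (3 * B + X + 2 * G + 11) + 1) (\<rho>', m) \<and>
      \<rho>' (r+3) = \<rho> (r+3) + (\<Sum>a\<in>{\<rho> v..<\<rho> v + int j}. f (\<rho>(v := a)) m) \<and>
      (\<forall>i<r+3. i \<noteq> v \<longrightarrow> i \<noteq> r \<longrightarrow> \<rho>' i = \<rho> i)"
proof (induction j arbitrary: \<rho>)
  case 0
  then have "runs w (\<rho>, m) 1 (\<rho>, m)"
    unfolding w_def using runs_WhilePos_False[of \<rho> r _ m] by auto
  then show ?case by auto
next
  case (Suc j \<rho>)
  have \<rho>B: "nat \<bar>\<rho> i\<bar> \<le> B" if "i < N" for i using Suc.prems(2)[OF that] Suc.prems(3) by (cases "i = v") auto
  obtain \<rho>1 where fG: "nat \<bar>f \<rho> m\<bar> \<le> G"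
    and 1: "runs p (\<rho>, m) G (\<rho>1, m)" "\<rho>1 (r+4) = f \<rho> m" "\<forall>i<r+4. \<rho>1 i = \<rho> i"
    using p[of \<rho>, OF \<rho>B] by blast
  let ?\<rho>2 = "\<rho>1(r+3 := \<rho> (r+3) + f \<rho> m)"
  let ?\<rho>3 = "?\<rho>2(r+4 := 1)"
  let ?\<rho>4 = "?\<rho>3(v := \<rho> v + 1)"
  let ?\<rho>5 = "?\<rho>4(r := int j)"
  have acc: "nat \<bar>\<rho> (r+3)\<bar> + nat \<bar>f \<rho> m\<bar> + j * G \<le> X" using Suc.prems(4) fG by simp
  have 2: "runs (Add (r+3) (r+3) (r+4)) (\<rho>1, m) (X + G + 2) (?\<rho>2, m)"
    using runs_Add[of "r+3" "r+3" "r+4" \<rho>1 m] 1 fG acc by (auto elim!: runs_mono)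
  have 3: "runs (Const (r+4) 1) (?\<rho>2, m) 2 (?\<rho>3, m)"
    using runs_Const[of "r+4" 1 ?\<rho>2 m] by (simp del: One_nat_def add: numeral_2_eq_2)
  have 4: "runs (Add v v (r+4)) (?\<rho>3, m) (B + 3) (?\<rho>4, m)"
    using runs_Add[of v v "r+4" ?\<rho>3 m] N 1 Suc.prems(3) by (auto elim!: runs_mono)
  have 5: "runs (Sub r r (r+4)) (?\<rho>4, m) (B + 3) (?\<rho>5, m)"
    using runs_Sub[of r r "r+4" ?\<rho>4 m] N 1 Suc.prems(1,3) by (auto elim!: runs_mono)
  note body = runs_Seq[OF 1(1) runs_Seq[OF 2 runs_Seq[OF 3 runs_Seq[OF 4 5]]]]
  have "\<exists>\<rho>'. runs w (?\<rho>5, m) (j * (3 * B + X + 2 * G + 11) + 1) (\<rho>', m) \<and>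
      \<rho>' (r+3) = ?\<rho>5 (r+3) + (\<Sum>a\<in>{?\<rho>5 v..<?\<rho>5 v + int j}. f (?\<rho>5(v := a)) m) \<and>
      (\<forall>i<r+3. i \<noteq> v \<longrightarrow> i \<noteq> r \<longrightarrow> \<rho>' i = ?\<rho>5 i)"
  proof (rule Suc.IH)
    show "nat \<bar>?\<rho>5 i\<bar> \<le> B" if "i < N" "i \<noteq> v" for i
      using that N 1 Suc.prems(2)[OF that] by simp
    show "nat \<bar>?\<rho>5 v\<bar> + j \<le> B" using N Suc.prems(3) by simp
    show "nat \<bar>?\<rho>5 (r+3)\<bar> + j * G \<le> X" using N acc by simp
  qed simp
  then obtain \<rho>' where \<rho>': "runs w (?\<rho>5, m) (j * (3 * B + X + 2 * G + 11) + 1) (\<rho>', m)"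
      "\<rho>' (r+3) = ?\<rho>5 (r+3) + (\<Sum>a\<in>{?\<rho>5 v..<?\<rho>5 v + int j}. f (?\<rho>5(v := a)) m)"
      "\<forall>i<r+3. i \<noteq> v \<longrightarrow> i \<noteq> r \<longrightarrow> \<rho>' i = ?\<rho>5 i" by blast
  have pos: "\<rho> r > 0" using Suc.prems(1) by simp
  have "runs w (\<rho>, m) (Suc j * (3 * B + X + 2 * G + 11) + 1) (\<rho>', m)"
    unfolding w_def
    by (rule runs_mono[OF runs_WhilePos_True[where x = \<rho> and i = r, OF pos body \<rho>'(1)[unfolded w_def]]])
      (use Suc.prems(1,3) in auto)
  moreover have "\<rho>' (r+3) = \<rho> (r+3) + (\<Sum>a\<in>{\<rho> v..<\<rho> v + int (Suc j)}. f (\<rho>(v := a)) m)"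
  proof -
    have "f (?\<rho>5(v := a)) m = f (\<rho>(v := a)) m" for a
      by (rule depends_belowD[OF f]) (use N 1 in auto)
    moreover have "{\<rho> v..<\<rho> v + int (Suc j)} = insert (\<rho> v) {\<rho> v + 1..<\<rho> v + 1 + int j}" by auto
    ultimately show ?thesis using \<rho>'(2) N by (simp add: add.assoc)
  qed
  moreover have "\<forall>i<r+3. i \<noteq> v \<longrightarrow> i \<noteq> r \<longrightarrow> \<rho>' i = \<rho> i" using \<rho>'(3) 1(3) by auto
  ultimately show ?case by blast
qed

text \<open>The summation variable is an argument register of \<open>f\<close>, so its old value has
  to be restored afterwards. The program makes no special case of an empty interval: the counter
  \<open>t - s\<close> is then not positive and the loop exits at once.\<close>

lemma feasible_sum:
  assumes "feasible s" "feasible t" "feasible f"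
  shows "feasible (\<lambda>\<rho> m. \<Sum>a\<in>{s \<rho> m..<t \<rho> m}. f (\<rho>(v := a)) m)"
proof -
  from assms(1) obtain gs N1 where 1: "poly_bounded gs" "\<And>N'. N1 \<le> N' \<Longrightarrow> depends_below N' s"
    "\<And>N' r. N1 \<le> N' \<Longrightarrow> N' \<le> r \<Longrightarrow> \<exists>p. evaluates N' s gs r p"
    by (rule feasibleE) blast
  from assms(2) obtain gt N2 where 2: "poly_bounded gt" "\<And>N'. N2 \<le> N' \<Longrightarrow> depends_below N' t"
    "\<And>N' r. N2 \<le> N' \<Longrightarrow> N' \<le> r \<Longrightarrow> \<exists>p. evaluates N' t gt r p"
    by (rule feasibleE) blast
  from assms(3) obtain gf N3 where 3: "poly_bounded gf" "\<And>N'. N3 \<le> N' \<Longrightarrow> depends_below N' f"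
    "\<And>N' r. N3 \<le> N' \<Longrightarrow> N' \<le> r \<Longrightarrow> \<exists>p. evaluates N' f gf r p"
    by (rule feasibleE) blast
  \<comment> \<open>\<open>gt B + 2 * gs B\<close> bounds \<open>|s|\<close> plus the number of
    rounds, hence the loop variable at all times; \<open>B\<close> covers the other
    arguments.\<close>
  define b where "b B = B + (gt B + 2 * gs B)" for B
  define G where "G B = gf (b B)" for B
  define X where "X B = (gt B + gs B) * G B" for B
  \<comment> \<open>The second summand \<open>gt B + gs B\<close> pays for the single test of a
    negative counter \<open>t - s\<close>.\<close>
  define W where "W B = (gt B + gs B) * (3 * b B + X B + 2 * G B + 11) + (gt B + gs B) + 1" for B
  define g where "g B = gt B + gs B + (gt B + gs B + 2) + (B + gs B + 9) + W B + (B + X B + 9)" for B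
  let ?F = "\<lambda>\<rho> m. \<Sum>a\<in>{s \<rho> m..<t \<rho> m}. f (\<rho>(v := a)) m"
  have pb: "poly_bounded b" unfolding b_def by (intro poly_bounded_intros 1 2)
  have pG: "poly_bounded G"
    unfolding G_def by (rule poly_bounded_compose[OF 3(1) pb]) (simp add: b_def)
  have pX: "poly_bounded X" unfolding X_def by (intro poly_bounded_intros 1 2 pG)
  have pg: "poly_bounded g" unfolding g_def W_def by (intro poly_bounded_intros 1 2 pG pX pb)
  show ?thesis
  proof (rule feasibleI[OF pg, of "Suc v + N1 + N2 + N3"])
    fix N assume N: "Suc v + N1 + N2 + N3 \<le> N"
    have dep: "depends_below N s" "depends_below N t" "depends_below N f"
      using N 1(2) 2(2) 3(2) by auto
    show "depends_below N ?F"
      unfolding depends_below_def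
    proof (intro allI impI)
      fix \<rho> \<rho>' :: "nat \<Rightarrow> int" and m assume eq: "\<forall>i<N. \<rho> i = \<rho>' i"
      have "s \<rho> m = s \<rho>' m" "t \<rho> m = t \<rho>' m" "f (\<rho>(v := a)) m = f (\<rho>'(v := a)) m" for a
        using eq by (auto intro: depends_belowD[OF dep(1)] depends_belowD[OF dep(2)] depends_belowD[OF dep(3)])
      then show "?F \<rho> m = ?F \<rho>' m" by simp
    qed
    fix r assume r: "N \<le> r"
    have v: "v < N" using N by simp
    obtain p1 p2 p3 where p: "evaluates N t gt r p1" "evaluates N s gs (r+1) p2" "evaluates N f gf (r+4) p3"
      using 2(3)[of N r] 1(3)[of N "r+1"] 3(3)[of N "r+4"] N r by auto
    define w where "w = WhilePos r (Seq p3 (Seq (Add (r+3) (r+3) (r+4)) (Seq (Const (r+4) 1)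
      (Seq (Add v v (r+4)) (Sub r r (r+4))))))"
    text \<open>Register \<open>r\<close> holds the number of remaining iterations, \<open>r + 2\<close> the saved value of the summation
      variable and \<open>r + 3\<close> the partial sum.\<close>
    define pre where "pre = Seq p1 (Seq p2 (Seq (Sub r r (r+1)) (Seq (Const (r+3) 0)
      (Seq (Add (r+2) v (r+3)) (Add v (r+1) (r+3))))))"
    define post where "post = Seq (Const r 0) (Seq (Add v (r+2) r) (Add r (r+3) r))"
    show "\<exists>p. evaluates N ?F g r p"
    proof (rule exI[of _ "Seq pre (Seq w post)"], rule evaluatesI)
      fix \<rho> and m :: "int \<Rightarrow> int" and B :: nat
      assume B: "2 \<le> B" "\<And>i. i < N \<Longrightarrow> nat \<bar>\<rho> i\<bar> \<le> B" "\<And>a. nat \<bar>m a\<bar> \<le> B"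
      have gt: "nat \<bar>t \<rho> m\<bar> \<le> gt B" and gs: "nat \<bar>s \<rho> m\<bar> \<le> gs B"
        using evaluatesD(1)[where \<rho> = \<rho> and m = m, OF p(1) B]
          evaluatesD(1)[where \<rho> = \<rho> and m = m, OF p(2) B] by auto
      have bB: "2 \<le> b B" "B \<le> b B" using B(1) by (auto simp: b_def)
      have f_bound: "nat \<bar>f \<rho>' m\<bar> \<le> G B" if "\<And>i. i < N \<Longrightarrow> nat \<bar>\<rho>' i\<bar> \<le> b B" for \<rho>'
        unfolding G_def by (rule evaluatesD(1)[OF p(3) bB(1) that]) (use B(3) bB(2) order_trans in blast)+
      have f_eval: "\<exists>\<rho>''. runs p3 (\<rho>', m) (G B) (\<rho>'', m) \<and> \<rho>'' (r+4) = f \<rho>' m \<and> (\<forall>i<r+4. \<rho>'' i = \<rho>' i)"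
        if "\<And>i. i < N \<Longrightarrow> nat \<bar>\<rho>' i\<bar> \<le> b B" for \<rho>'
        unfolding G_def by (rule evaluatesD(2)[OF p(3) bB(1) that]) (use B(3) bB(2) order_trans in blast)+
      have "nat \<bar>?F \<rho> m\<bar> \<le> X B"
      proof -
        have "\<bar>?F \<rho> m\<bar> \<le> (\<Sum>a\<in>{s \<rho> m..<t \<rho> m}. \<bar>f (\<rho>(v := a)) m\<bar>)" by (rule sum_abs)
        also have "\<dots> \<le> (\<Sum>a\<in>{s \<rho> m..<t \<rho> m}. int (G B))"
        proof (rule sum_mono)
          fix a assume "a \<in> {s \<rho> m..<t \<rho> m}"
          then have "nat \<bar>a\<bar> \<le> b B" using gt gs by (auto simp: b_def)
          then have "nat \<bar>f (\<rho>(v := a)) m\<bar> \<le> G B"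
            using B(2) bB(2) order_trans by (intro f_bound) (auto simp del: nat_le_iff)
          then show "\<bar>f (\<rho>(v := a)) m\<bar> \<le> int (G B)" by simp
        qed
        also have "\<dots> = int (nat (t \<rho> m - s \<rho> m) * G B)" by simp
        also have "nat (t \<rho> m - s \<rho> m) * G B \<le> X B"
          unfolding X_def using gt gs by (intro mult_right_mono) auto
        finally show ?thesis by simp
      qed
      then show "nat \<bar>?F \<rho> m\<bar> \<le> g B" by (simp add: g_def)
      obtain \<rho>1 where \<rho>1: "runs p1 (\<rho>, m) (gt B) (\<rho>1, m)" "\<rho>1 r = t \<rho> m" "\<forall>i<r. \<rho>1 i = \<rho> i"
        using evaluatesD(2)[where \<rho> = \<rho> and m = m, OF p(1) B] by blast
      have "\<And>i. i < N \<Longrightarrow> nat \<bar>\<rho>1 i\<bar> \<le> B" using B(2) \<rho>1(3) r by simp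
      from evaluatesD(2)[where \<rho> = \<rho>1 and m = m, OF p(2) B(1) this B(3)] obtain \<rho>2
        where \<rho>2: "runs p2 (\<rho>1, m) (gs B) (\<rho>2, m)" "\<rho>2 (r+1) = s \<rho>1 m" "\<forall>i<r+1. \<rho>2 i = \<rho>1 i"
        by blast
      have s: "s \<rho>1 m = s \<rho> m"
        by (rule depends_belowD[OF dep(1)]) (use r \<rho>1(3) in auto)
      have \<rho>2': "\<rho>2 r = t \<rho> m" "\<rho>2 (r+1) = s \<rho> m" "\<And>i. i < r \<Longrightarrow> \<rho>2 i = \<rho> i"
        using \<rho>1 \<rho>2 s by auto
      let ?\<rho>3 = "\<rho>2(r := t \<rho> m - s \<rho> m)"
      let ?\<rho>4 = "?\<rho>3(r+3 := 0)"
      let ?\<rho>5 = "?\<rho>4(r+2 := \<rho> v)"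
      let ?\<rho>6 = "?\<rho>5(v := s \<rho> m)"
      have vB: "nat \<bar>\<rho> v\<bar> \<le> B" using B(2) v by simp
      have 3: "runs (Sub r r (r+1)) (\<rho>2, m) (gt B + gs B + 2) (?\<rho>3, m)"
        using runs_Sub[of r r "r+1" \<rho>2 m] gt gs \<rho>2' by (auto elim!: runs_mono)
      have 4: "runs (Const (r+3) 0) (?\<rho>3, m) 1 (?\<rho>4, m)"
        using runs_Const[of "r+3" 0 ?\<rho>3 m] by simp
      have 5: "runs (Add (r+2) v (r+3)) (?\<rho>4, m) (B + 2) (?\<rho>5, m)"
        using runs_Add[of "r+2" v "r+3" ?\<rho>4 m] v r \<rho>2' vB by (auto elim!: runs_mono)
      have 6: "runs (Add v (r+1) (r+3)) (?\<rho>5, m) (gs B + 2) (?\<rho>6, m)"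
        using runs_Add[of v "r+1" "r+3" ?\<rho>5 m] v r \<rho>2' gs by (auto elim!: runs_mono)
      have pre: "runs pre (\<rho>, m) (gt B + gs B + (gt B + gs B + 2) + (B + gs B + 5)) (?\<rho>6, m)"
        unfolding pre_def
        by (rule runs_mono[OF runs_Seq[OF \<rho>1(1) runs_Seq[OF \<rho>2(1) runs_Seq[OF 3 runs_Seq[OF 4 runs_Seq[OF 5 6]]]]]])
          simp
      have fv: "f (?\<rho>6(v := a)) m = f (\<rho>(v := a)) m" for a
        by (rule depends_belowD[OF dep(3)]) (use v r \<rho>2' in auto)
      have "\<exists>\<rho>'. runs w (?\<rho>6, m) (W B) (\<rho>', m) \<and> \<rho>' (r+3) = ?F \<rho> m \<and>
        (\<forall>i<r+3. i \<noteq> v \<longrightarrow> i \<noteq> r \<longrightarrow> \<rho>' i = ?\<rho>6 i)"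
      proof (cases "s \<rho> m < t \<rho> m")
        case False
        then have "runs w (?\<rho>6, m) (nat \<bar>?\<rho>6 r\<bar> + 1) (?\<rho>6, m)"
          unfolding w_def by (intro runs_WhilePos_False) (use v r in auto)
        then have "runs w (?\<rho>6, m) (W B) (?\<rho>6, m)"
          by (rule runs_mono) (use v r gt gs in \<open>auto simp: W_def\<close>)
        moreover have "?\<rho>6 (r+3) = ?F \<rho> m" using False v r by simp
        ultimately show ?thesis by blast
      next
        case True
        define j where "j = nat (t \<rho> m - s \<rho> m)"
        have j: "int j = t \<rho> m - s \<rho> m" "j \<le> gt B + gs B" using True gt gs by (auto simp: j_def)
        have "\<exists>\<rho>'. runs w (?\<rho>6, m) (j * (3 * b B + X B + 2 * G B + 11) + 1) (\<rho>', m) \<and>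
          \<rho>' (r+3) = ?\<rho>6 (r+3) + (\<Sum>a\<in>{?\<rho>6 v..<?\<rho>6 v + int j}. f (?\<rho>6(v := a)) m) \<and>
          (\<forall>i<r+3. i \<noteq> v \<longrightarrow> i \<noteq> r \<longrightarrow> \<rho>' i = ?\<rho>6 i)"
          unfolding w_def
        proof (rule runs_sum_loop[OF conjI dep(3) v r])
          show "?\<rho>6 r = int j" using v r j by simp
          show "nat \<bar>?\<rho>6 i\<bar> \<le> b B" if "i < N" "i \<noteq> v" for i
            using that r \<rho>2'(3)[of i] B(2)[of i] bB by simp
          show "nat \<bar>?\<rho>6 v\<bar> + j \<le> b B" using gs j by (simp add: b_def)
          have "j * G B \<le> X B" unfolding X_def using j by (intro mult_right_mono) auto
          then show "nat \<bar>?\<rho>6 (r+3)\<bar> + j * G B \<le> X B" using v r by simp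
        qed (use f_bound f_eval in blast)+
        then obtain \<rho>' where \<rho>': "runs w (?\<rho>6, m) (j * (3 * b B + X B + 2 * G B + 11) + 1) (\<rho>', m)"
          "\<rho>' (r+3) = ?\<rho>6 (r+3) + (\<Sum>a\<in>{?\<rho>6 v..<?\<rho>6 v + int j}. f (?\<rho>6(v := a)) m)"
          "\<forall>i<r+3. i \<noteq> v \<longrightarrow> i \<noteq> r \<longrightarrow> \<rho>' i = ?\<rho>6 i" by blast
        have "j * (3 * b B + X B + 2 * G B + 11) + 1 \<le> W B"
          unfolding W_def by (rule add_mono[OF trans_le_add1[OF mult_right_mono[OF j(2)]]]) simp_all
        with \<rho>'(1) have "runs w (?\<rho>6, m) (W B) (\<rho>', m)" by (rule runs_mono)
        moreover have "\<rho>' (r+3) = ?F \<rho> m" using \<rho>'(2) v r j fv by simp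
        ultimately show ?thesis using \<rho>'(3) by blast
      qed
      then obtain \<rho>7 where \<rho>7: "runs w (?\<rho>6, m) (W B) (\<rho>7, m)" "\<rho>7 (r+3) = ?F \<rho> m"
        "\<forall>i<r+3. i \<noteq> v \<longrightarrow> i \<noteq> r \<longrightarrow> \<rho>7 i = ?\<rho>6 i" by blast
      let ?\<rho>8 = "\<rho>7(r := 0)"
      let ?\<rho>9 = "?\<rho>8(v := \<rho> v)"
      let ?\<rho>10 = "?\<rho>9(r := ?F \<rho> m)"
      have sv: "\<rho>7 (r+2) = \<rho> v" using \<rho>7(3) v r by simp
      have 8: "runs (Const r 0) (\<rho>7, m) 1 (?\<rho>8, m)"
        using runs_Const[of r 0 \<rho>7 m] by simp
      have 9: "runs (Add v (r+2) r) (?\<rho>8, m) (B + 2) (?\<rho>9, m)"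
        using runs_Add[of v "r+2" r ?\<rho>8 m] v r sv vB by (auto elim!: runs_mono)
      have 10: "runs (Add r (r+3) r) (?\<rho>9, m) (X B + 2) (?\<rho>10, m)"
        using runs_Add[of r "r+3" r ?\<rho>9 m] v r \<rho>7(2) \<open>nat \<bar>?F \<rho> m\<bar> \<le> X B\<close> by (auto elim!: runs_mono)
      have "runs (Seq pre (Seq w post)) (\<rho>, m) (g B) (?\<rho>10, m)"
        unfolding post_def
        by (rule runs_mono[OF runs_Seq[OF pre runs_Seq[OF \<rho>7(1) runs_Seq[OF 8 runs_Seq[OF 9 10]]]]])
          (simp add: g_def)
      moreover have "\<forall>i<r. ?\<rho>10 i = \<rho> i" using \<rho>7(3) \<rho>2'(3) by auto
      moreover have "?\<rho>10 r = ?F \<rho> m" by simp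
      ultimately show "\<exists>\<rho>'. runs (Seq pre (Seq w post)) (\<rho>, m) (g B) (\<rho>', m) \<and> \<rho>' r = ?F \<rho> m \<and>
          (\<forall>i<r. \<rho>' i = \<rho> i)" by blast
    qed
  qed
qed

text \<open>Matches sums with a bound variable as they occur in definitions; the last assumption
  says that register \<open>v\<close> is fresh for \<open>f\<close>.\<close>

lemma feasible_sum_var:
  assumes "feasible s" "feasible t" "feasible (\<lambda>\<rho> m. f \<rho> m (\<rho> v))"
    and "\<And>\<rho> m a b. f (\<rho>(v := b)) m a = f \<rho> m a"
  shows "feasible (\<lambda>\<rho> m. \<Sum>a\<in>{s \<rho> m..<t \<rho> m}. f \<rho> m a)"
  using feasible_sum[OF assms(1-3), of v] by (simp add: assms(4))

lemma feasible_finite_sum: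
  assumes "finite A" "\<And>i. i \<in> A \<Longrightarrow> feasible (f i)"
  shows "feasible (\<lambda>\<rho> m. \<Sum>i\<in>A. f i \<rho> m)"
  using assms by (induction A) (auto intro: feasible_const feasible_add)

lemma feasible_finite_prod:
  assumes "finite A" "\<And>i. i \<in> A \<Longrightarrow> feasible (f i)"
  shows "feasible (\<lambda>\<rho> m. \<Prod>i\<in>A. f i \<rho> m)"
  using assms by (induction A) (auto intro: feasible_const feasible_mult)

lemma feasible_power: "feasible f \<Longrightarrow> feasible (\<lambda>\<rho> m. f \<rho> m ^ k)"
  by (induction k) (auto intro: feasible_const feasible_mult)

section \<open>Decidable predicates and bounded quantifiers\<close>

definition decidable :: "bool valuation \<Rightarrow> bool" where
  "decidable P \<longleftrightarrow> feasible (\<lambda>\<rho> m. of_bool (P \<rho> m))"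

lemma decidable_less: "feasible f \<Longrightarrow> feasible g \<Longrightarrow> decidable (\<lambda>\<rho> m. f \<rho> m < g \<rho> m)"
  unfolding decidable_def using feasible_pos[OF feasible_diff[of g f]] by simp

lemma decidable_not:
  assumes "decidable P"
  shows "decidable (\<lambda>\<rho> m. \<not> P \<rho> m)"
proof -
  have "of_bool (\<not> P \<rho> m) = 1 - (of_bool (P \<rho> m) :: int)" for \<rho> m by simp
  then show ?thesis
    using feasible_diff[OF feasible_const[of 1] assms[unfolded decidable_def]] unfolding decidable_def by simp
qed

lemma decidable_conj:
  assumes "decidable P" "decidable Q"
  shows "decidable (\<lambda>\<rho> m. P \<rho> m \<and> Q \<rho> m)"
  using feasible_mult[OF assms[unfolded decidable_def]] unfolding decidable_def
  by (simp add: of_bool_conj)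

lemma decidable_eq: "feasible f \<Longrightarrow> feasible g \<Longrightarrow> decidable (\<lambda>\<rho> m. f \<rho> m = g \<rho> m)"
  using decidable_conj[OF decidable_not[OF decidable_less] decidable_not[OF decidable_less], of f g g f]
  by (simp add: not_less eq_iff[of "f _ _"] conj_commute)

lemma decidable_finite_Ball:
  assumes "finite A" "\<And>i. i \<in> A \<Longrightarrow> decidable (P i)"
  shows "decidable (\<lambda>\<rho> m. \<forall>i\<in>A. P i \<rho> m)"
  using assms
proof (induction A)
  case empty
  then show ?case by (simp add: decidable_def feasible_const)
qed (auto intro: decidable_conj)

lemma decidable_Bex:
  assumes "feasible s" "feasible t" "decidable P"
  shows "decidable (\<lambda>\<rho> m. \<exists>a\<in>{s \<rho> m..<t \<rho> m}. P (\<rho>(v := a)) m)"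
proof -
  \<comment> \<open>Existence is positivity of the number of witnesses.\<close>
  have *: "(0 < (\<Sum>a\<in>{s \<rho> m..<t \<rho> m}. of_bool (P (\<rho>(v := a)) m) :: int)) \<longleftrightarrow>
      (\<exists>a\<in>{s \<rho> m..<t \<rho> m}. P (\<rho>(v := a)) m)" for \<rho> m
    by (subst less_le) (auto simp: sum_nonneg sum_nonneg_eq_0_iff eq_commute[of 0])
  show ?thesis
    using decidable_less[OF feasible_const[of 0] feasible_sum[OF assms(1,2) assms(3)[unfolded decidable_def], of v]]
    by (simp only: *)
qed

lemma decidable_Ball_var:
  assumes "feasible s" "feasible t" "decidable (\<lambda>\<rho> m. P \<rho> m (\<rho> v))"
    and "\<And>\<rho> m a b. P (\<rho>(v := b)) m a = P \<rho> m a"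
  shows "decidable (\<lambda>\<rho> m. \<forall>a\<in>{s \<rho> m..<t \<rho> m}. P \<rho> m a)"
  using decidable_not[OF decidable_Bex[OF assms(1,2) decidable_not[OF assms(3)], of v]]
  by (simp add: assms(4))

text \<open>Each register of \<open>A\<close> adds one nested loop; the depth is fixed with the
  program, so the cost stays polynomial. The bound \<open>R\<close> depends on the memory only, so
  assigning the quantified registers does not alter it.\<close>

lemma decidable_Ex_registers:
  assumes "finite A" "feasible (\<lambda>_. R)" "decidable P"
  shows "decidable (\<lambda>\<rho> m. \<exists>\<rho>'. (\<forall>i. i \<notin> A \<longrightarrow> \<rho>' i = \<rho> i) \<and> (\<forall>i\<in>A. \<bar>\<rho>' i\<bar> \<le> R m) \<and> P \<rho>' m)"
  using assms(1)
proof (induction A)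
  case empty
  have "(\<forall>i. \<rho>' i = \<rho> i) \<longleftrightarrow> \<rho>' = \<rho>" for \<rho>' \<rho> :: "nat \<Rightarrow> int" by auto
  then show ?case using assms(3) by simp
next
  case (insert v A)
  let ?Q = "\<lambda>\<rho> m. \<exists>\<rho>'. (\<forall>i. i \<notin> A \<longrightarrow> \<rho>' i = \<rho> i) \<and> (\<forall>i\<in>A. \<bar>\<rho>' i\<bar> \<le> R m) \<and> P \<rho>' m"
  have "decidable (\<lambda>\<rho> m. \<exists>a\<in>{- R m..<R m + 1}. ?Q (\<rho>(v := a)) m)"
    by (intro decidable_Bex insert.IH feasible_uminus feasible_add feasible_const assms(2))
  moreover have "(\<exists>a\<in>{- R m..<R m + 1}. ?Q (\<rho>(v := a)) m) \<longleftrightarrow>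
    (\<exists>\<rho>'. (\<forall>i. i \<notin> insert v A \<longrightarrow> \<rho>' i = \<rho> i) \<and> (\<forall>i\<in>insert v A. \<bar>\<rho>' i\<bar> \<le> R m) \<and> P \<rho>' m)" for \<rho> m
  proof
    assume "\<exists>a\<in>{- R m..<R m + 1}. ?Q (\<rho>(v := a)) m"
    then obtain a where a: "a \<in> {- R m..<R m + 1}" "?Q (\<rho>(v := a)) m" by blast
    from a(2) obtain \<rho>' where \<rho>': "\<forall>i. i \<notin> A \<longrightarrow> \<rho>' i = (\<rho>(v := a)) i"
      "\<forall>i\<in>A. \<bar>\<rho>' i\<bar> \<le> R m" "P \<rho>' m" by blast
    then show "\<exists>\<rho>'. (\<forall>i. i \<notin> insert v A \<longrightarrow> \<rho>' i = \<rho> i) \<and> (\<forall>i\<in>insert v A. \<bar>\<rho>' i\<bar> \<le> R m) \<and> P \<rho>' m"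
      using insert.hyps a(1) by (intro exI[of _ \<rho>']) auto
  next
    assume "\<exists>\<rho>'. (\<forall>i. i \<notin> insert v A \<longrightarrow> \<rho>' i = \<rho> i) \<and> (\<forall>i\<in>insert v A. \<bar>\<rho>' i\<bar> \<le> R m) \<and> P \<rho>' m"
    then obtain \<rho>' where \<rho>': "\<forall>i. i \<notin> insert v A \<longrightarrow> \<rho>' i = \<rho> i"
      "\<forall>i\<in>insert v A. \<bar>\<rho>' i\<bar> \<le> R m" "P \<rho>' m" by blast
    then have "?Q (\<rho>(v := \<rho>' v)) m" by (intro exI[of _ \<rho>']) auto
    moreover have "\<rho>' v \<in> {- R m..<R m + 1}" using \<rho>'(2) by auto
    ultimately show "\<exists>a\<in>{- R m..<R m + 1}. ?Q (\<rho>(v := a)) m" by blast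
  qed
  ultimately show ?case by simp
qed

lemma feasible_computable:
  assumes "feasible f"
  obtains p K where "\<And>m B. 2 \<le> B \<Longrightarrow> (\<And>a. nat \<bar>m a\<bar> \<le> B) \<Longrightarrow>
    \<exists>\<rho>. runs p (\<lambda>_. 0, m) (B ^ K) (\<rho>, m) \<and> \<rho> 0 = f (\<lambda>_. 0) m"
proof -
  from assms obtain g N where 1: "poly_bounded g" "\<And>N'. N \<le> N' \<Longrightarrow> depends_below N' f"
    "\<And>N' r. N \<le> N' \<Longrightarrow> N' \<le> r \<Longrightarrow> \<exists>p. evaluates N' f g r p"
    by (rule feasibleE) blast
  \<comment> \<open>\<open>N + 1\<close> keeps the result away from register \<open>0\<close>, which
    is cleared before the result is copied there.\<close>
  obtain p where p: "evaluates N f g (N + 1) p" using 1(3)[of N "N + 1"] by auto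
  have "poly_bounded (\<lambda>B. g B + (1 + (g B + 2)))" by (intro poly_bounded_intros 1)
  then obtain K where K: "\<And>B. 2 \<le> B \<Longrightarrow> g B + (1 + (g B + 2)) \<le> B ^ K"
    unfolding poly_bounded_def by blast
  show thesis
  proof (rule that[of "Seq p (Seq (Const 0 0) (Add 0 (N + 1) 0))" K])
    fix m :: "int \<Rightarrow> int" and B :: nat assume B: "2 \<le> B" "\<And>a. nat \<bar>m a\<bar> \<le> B"
    have 0: "nat \<bar>0 :: int\<bar> \<le> B" by simp
    obtain \<rho> where \<rho>: "runs p (\<lambda>_. 0, m) (g B) (\<rho>, m)" "\<rho> (N + 1) = f (\<lambda>_. 0) m"
      using evaluatesD(2)[where \<rho> = "\<lambda>_. 0" and m = m, OF p B(1) 0 B(2)] by blast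
    have f: "nat \<bar>f (\<lambda>_. 0) m\<bar> \<le> g B" by (rule evaluatesD(1)[OF p B(1) 0 B(2)])
    let ?\<rho> = "\<rho>(0 := 0, 0 := f (\<lambda>_. 0) m)"
    have "runs (Const 0 0) (\<rho>, m) 1 (\<rho>(0 := 0), m)" using runs_Const[of 0 0 \<rho> m] by simp
    moreover have "runs (Add 0 (N + 1) 0) (\<rho>(0 := 0), m) (g B + 2) (?\<rho>, m)"
      using runs_Add[of 0 "N + 1" 0 "\<rho>(0 := 0)" m] \<rho>(2) f by (auto elim!: runs_mono)
    ultimately have "runs (Seq p (Seq (Const 0 0) (Add 0 (N + 1) 0))) (\<lambda>_. 0, m) (B ^ K) (?\<rho>, m)"
      by (rule runs_mono[OF runs_Seq[OF \<rho>(1) runs_Seq] K[OF B(1)]])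
    then show "\<exists>\<rho>. runs (Seq p (Seq (Const 0 0) (Add 0 (N + 1) 0))) (\<lambda>_. 0, m) (B ^ K) (\<rho>, m) \<and>
        \<rho> 0 = f (\<lambda>_. 0) m"
      by (intro exI[of _ ?\<rho>]) simp
  qed
qed

section \<open>Small integer vectors\<close>

text \<open>Pigeonhole: the box \<open>{0..M}\<close> in the coordinates \<open>J\<close> has more
  points than the box that contains their images, and the difference of two points with the same
  image is a small nonzero solution. The exponent \<open>card I\<close> is cruder than the usual
  \<open>card I / (card J - card I)\<close>, but gives a polynomial in \<open>H\<close> for
  \<open>I\<close> and \<open>J\<close> of fixed size.\<close>

lemma siegel:
  fixes a :: "'i \<Rightarrow> 'j \<Rightarrow> int" and H :: int
  assumes fin: "finite I" "finite J" and card: "card I < card J"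
    and H: "0 \<le> H" "\<And>i j. i \<in> I \<Longrightarrow> j \<in> J \<Longrightarrow> \<bar>a i j\<bar> \<le> H"
  shows "\<exists>x. (\<exists>j\<in>J. x j \<noteq> 0) \<and> (\<forall>j\<in>J. \<bar>x j\<bar> \<le> (2 * int (card J) * H + 1) ^ card I) \<and>
    (\<forall>i\<in>I. (\<Sum>j\<in>J. a i j * x j) = 0)"
proof -
  define q where "q = 2 * int (card J) * H + 1"
  \<comment> \<open>Chosen so that \<open>(q * M) ^ card I\<close>, which bounds the number of
    possible images, equals \<open>M ^ Suc (card I)\<close> and thus is at most
    \<open>M ^ card J\<close>.\<close>
  define M where "M = q ^ card I"
  define V where "V = int (card J) * H * M"
  have q: "1 \<le> q" using H(1) by (simp add: q_def)
  have M: "1 \<le> M" unfolding M_def using q by (rule one_le_power)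
  have V: "0 \<le> V" unfolding V_def using H(1) M by simp
  define X where "X = (\<Pi>\<^sub>E j\<in>J. {0..M})"
  define Y where "Y = (\<Pi>\<^sub>E i\<in>I. {-V..V})"
  define f where "f x = (\<lambda>i\<in>I. \<Sum>j\<in>J. a i j * x j)" for x
  have "f ` X \<subseteq> Y"
  proof
    fix y assume "y \<in> f ` X"
    then obtain x where x: "x \<in> X" "y = f x" by blast
    have "(\<Sum>j\<in>J. a i j * x j) \<in> {-V..V}" if i: "i \<in> I" for i
    proof -
      have "\<bar>\<Sum>j\<in>J. a i j * x j\<bar> \<le> (\<Sum>j\<in>J. \<bar>a i j * x j\<bar>)" by (rule sum_abs)
      also have "\<dots> \<le> (\<Sum>j\<in>J. H * M)"
      proof (rule sum_mono)
        fix j assume j: "j \<in> J"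
        have "x j \<in> {0..M}" using x(1) j unfolding X_def by (rule PiE_mem)
        then show "\<bar>a i j * x j\<bar> \<le> H * M"
          unfolding abs_mult using H j i by (intro mult_mono) auto
      qed
      also have "\<dots> = V" by (simp add: V_def)
      finally show ?thesis by auto
    qed
    then show "y \<in> Y" unfolding x(2) f_def Y_def by (intro PiE_I) auto
  qed
  moreover have "finite Y" unfolding Y_def using fin by (intro finite_PiE) auto
  ultimately have "card (f ` X) \<le> card Y" by (intro card_mono)
  also have "\<dots> < card X"
  proof -
    have "int (card Y) = (2 * V + 1) ^ card I"
      unfolding Y_def using fin V by (simp add: card_PiE)
    also have "\<dots> \<le> (q * M) ^ card I"
    proof (rule power_mono)
      show "2 * V + 1 \<le> q * M" using M unfolding q_def V_def by (simp add: algebra_simps)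
    qed (use V in simp)
    also have "\<dots> = M ^ Suc (card I)" by (simp add: power_mult_distrib M_def)
    also have "\<dots> \<le> M ^ card J" using M card by (intro power_increasing) auto
    also have "\<dots> < (M + 1) ^ card J" using M card by (intro power_strict_mono) auto
    also have "\<dots> = int (card X)"
      unfolding X_def using fin M by (simp add: card_PiE)
    finally show ?thesis by simp
  qed
  finally have "\<not> inj_on f X" by (rule pigeonhole)
  then obtain x y where xy: "x \<in> X" "y \<in> X" "x \<noteq> y" "f x = f y" unfolding inj_on_def by blast
  show ?thesis
  proof (intro exI[of _ "\<lambda>j. x j - y j"] conjI ballI)
    show "\<exists>j\<in>J. x j - y j \<noteq> 0"
      using xy(3) PiE_ext[OF xy(1,2)[unfolded X_def]] by auto
    show "\<bar>x j - y j\<bar> \<le> (2 * int (card J) * H + 1) ^ card I" if "j \<in> J" for j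
      using PiE_mem[OF xy(1)[unfolded X_def] that] PiE_mem[OF xy(2)[unfolded X_def] that]
      unfolding M_def q_def by auto
    show "(\<Sum>j\<in>J. a i j * (x j - y j)) = 0" if "i \<in> I" for i
      using fun_cong[OF xy(4), of i] that by (simp add: f_def right_diff_distrib sum_subtractf)
  qed
qed

section \<open>Integer vectors and orthogonality\<close>

definition real_vec :: "int ^ 'n \<Rightarrow> real ^ 'n" where
  "real_vec c = (\<chi> i. real_of_int (c $ i))"

definition int_inner :: "int ^ 'n \<Rightarrow> int ^ 'n::finite \<Rightarrow> int" where
  "int_inner c x = (\<Sum>i\<in>UNIV. c $ i * x $ i)"

lemma real_vec_nth [simp]: "real_vec c $ i = real_of_int (c $ i)"
  by (simp add: real_vec_def)

lemma real_vec_eq_0_iff [simp]: "real_vec c = 0 \<longleftrightarrow> c = 0"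
  by (simp add: vec_eq_iff)

lemma inner_real_vec: "real_vec c \<bullet> real_vec x = real_of_int (int_inner c x)"
  by (simp add: inner_vec_def int_inner_def)

lemma orthogonal_to_span:
  fixes v :: "'a :: euclidean_space"
  assumes "\<And>b. b \<in> B \<Longrightarrow> v \<bullet> b = 0" "u \<in> span B"
  shows "v \<bullet> u = 0"
proof -
  have "span B \<subseteq> {u. v \<bullet> u = 0}"
    using assms(1) by (intro span_minimal subspace_hyperplane) auto
  then show ?thesis using assms(2) by blast
qed

text \<open>\<open>c0\<close> forces \<open>E\<close> into a hyperplane, so a basis chosen from
  \<open>E\<close> itself gives fewer equations than unknowns, with coefficients bounded by
  \<open>H\<close>. Orthogonality to this basis carries over to all of \<open>E\<close>, however
  large.\<close>

lemma small_orthogonal: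
  fixes E :: "(int ^ 'n::finite) set" and c0 :: "int ^ 'n"
  assumes H: "0 \<le> H" "\<And>x i. x \<in> E \<Longrightarrow> \<bar>x $ i\<bar> \<le> H"
    and c0: "c0 \<noteq> 0" "\<And>x. x \<in> E \<Longrightarrow> int_inner c0 x = 0"
  obtains c where "c \<noteq> 0" "\<And>i. \<bar>c $ i\<bar> \<le> (2 * int CARD('n) * H + 1) ^ CARD('n)"
    "\<And>x. x \<in> E \<Longrightarrow> int_inner c x = 0"
proof -
  obtain B where B: "B \<subseteq> real_vec ` E" "independent B" "real_vec ` E \<subseteq> span B"
    "card B = dim (real_vec ` E)"
    using basis_exists[of "real_vec ` E"] by blast
  have "real_vec ` E \<subseteq> {x. real_vec c0 \<bullet> x = 0}" using c0(2) by (auto simp: inner_real_vec)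
  then have "dim (real_vec ` E) \<le> dim {x. real_vec c0 \<bullet> x = 0}" by (rule dim_subset)
  also have "\<dots> = CARD('n) - 1" using c0(1) by (simp add: dim_hyperplane)
  finally have "card B \<le> CARD('n) - 1" by (simp add: B(4))
  then have card: "card B < card (UNIV :: 'n set)"
    using zero_less_card_finite[where 'a = 'n] by linarith
  have "\<forall>b\<in>B. \<exists>x\<in>E. real_vec x = b" using B(1) by auto
  then obtain g where g: "\<And>b. b \<in> B \<Longrightarrow> g b \<in> E" "\<And>b. b \<in> B \<Longrightarrow> real_vec (g b) = b" by metis
  have "\<bar>g b $ j\<bar> \<le> H" if "b \<in> B" for b j by (rule H(2)[OF g(1)[OF that]])
  from siegel[of B UNIV H "\<lambda>b j. g b $ j", OF independent_imp_finite[OF B(2)] finite card H(1) this]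
  obtain x where "\<exists>j\<in>UNIV. x j \<noteq> 0" "\<forall>j\<in>UNIV. \<bar>x j\<bar> \<le> (2 * int CARD('n) * H + 1) ^ card B"
    "\<forall>b\<in>B. (\<Sum>j\<in>UNIV. g b $ j * x j) = 0" by blast
  then have x: "\<exists>j. x j \<noteq> 0" "\<And>j. \<bar>x j\<bar> \<le> (2 * int CARD('n) * H + 1) ^ card B"
    "\<And>b. b \<in> B \<Longrightarrow> (\<Sum>j\<in>UNIV. g b $ j * x j) = 0" by simp_all
  let ?c = "(\<chi> j. x j) :: int ^ 'n"
  show thesis
  proof (rule that[of ?c])
    show "?c \<noteq> 0" using x(1) by (auto simp: vec_eq_iff)
    have "(2 * int CARD('n) * H + 1) ^ card B \<le> (2 * int CARD('n) * H + 1) ^ CARD('n)"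
      using H(1) card by (intro power_increasing) auto
    with x(2) show "\<bar>?c $ i\<bar> \<le> (2 * int CARD('n) * H + 1) ^ CARD('n)" for i
      by (auto intro: order_trans)
    have B0: "real_vec ?c \<bullet> b = 0" if "b \<in> B" for b
    proof -
      have "real_vec ?c \<bullet> real_vec (g b) = 0"
        unfolding inner_real_vec using x(3)[OF that] by (simp add: int_inner_def mult.commute)
      then show ?thesis using g(2)[OF that] by simp
    qed
    show "int_inner ?c y = 0" if "y \<in> E" for y
      using orthogonal_to_span[where u = "real_vec y", OF B0] B(3) that
      by (auto simp: inner_real_vec)
  qed
qed

text \<open>The solutions of the tight constraints of a point with the largest possible tight set are all
  feasible: moving towards an infeasible one would make a further independent constraint tight.\<close>

lemma tight_face_feasible:
  fixes W :: "'a :: euclidean_space set"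
  assumes W: "finite W" and a0: "\<And>w. w \<in> W \<Longrightarrow> 1 \<le> a0 \<bullet> w"
  obtains a where "\<And>v w. \<lbrakk>\<And>u. u \<in> W \<Longrightarrow> a \<bullet> u = 1 \<Longrightarrow> v \<bullet> u = 1; w \<in> W\<rbrakk> \<Longrightarrow> 1 \<le> v \<bullet> w"
proof -
  define T where "T a = {w \<in> W. a \<bullet> w = 1}" for a
  obtain a where a: "\<And>w. w \<in> W \<Longrightarrow> 1 \<le> a \<bullet> w"
    and max: "\<And>p. (\<And>w. w \<in> W \<Longrightarrow> 1 \<le> p \<bullet> w) \<Longrightarrow> dim (T p) \<le> dim (T a)"
    using ex_has_greatest_nat[of "\<lambda>a. \<forall>w\<in>W. 1 \<le> a \<bullet> w" a0 "\<lambda>a. dim (T a)" "Suc DIM('a)"]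
      a0 dim_subset_UNIV by (metis less_Suc_eq_le)
  show thesis
  proof (rule that[of a], rule ccontr)
    fix v w assume v: "\<And>u. u \<in> W \<Longrightarrow> a \<bullet> u = 1 \<Longrightarrow> v \<bullet> u = 1" and w: "w \<in> W" "\<not> 1 \<le> v \<bullet> w"
    define W' where "W' = {w \<in> W. v \<bullet> w < 1}"
    \<comment> \<open>The fraction of the way from \<open>a\<close> to \<open>v\<close> at which the
      constraint \<open>w\<close> becomes tight; the smallest one is met first.\<close>
    define s where "s w = (a \<bullet> w - 1) / (a \<bullet> w - v \<bullet> w)" for w
    have "finite W'" "W' \<noteq> {}" using W w by (auto simp: W'_def)
    then obtain z where z: "z \<in> W'" and min: "\<And>w. w \<in> W' \<Longrightarrow> s z \<le> s w"
      using ex_is_arg_min_if_finite[of W' s] unfolding is_arg_min_linorder by blast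
    \<comment> \<open>A constraint tight at \<open>a\<close> is also tight at \<open>v\<close>, so
      those violated by \<open>v\<close> have slack at \<open>a\<close>.\<close>
    have gt: "1 < a \<bullet> w" if "w \<in> W'" for w
      using that a[of w] v[of w] unfolding W'_def by force
    have s01: "0 \<le> s z" "s z \<le> 1"
      using gt[OF z] z unfolding s_def W'_def by (auto simp: field_simps)
    define p where "p = a + s z *\<^sub>R (v - a)"
    have p: "p \<bullet> w = a \<bullet> w - s z * (a \<bullet> w - v \<bullet> w)" for w
      by (simp add: p_def inner_add_left inner_diff_left algebra_simps)
    have "1 \<le> p \<bullet> w" if w: "w \<in> W" for w
    proof (cases "w \<in> W'")
      case True
      have "s z * (a \<bullet> w - v \<bullet> w) \<le> s w * (a \<bullet> w - v \<bullet> w)"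
        using min[OF True] gt[OF True] True by (intro mult_right_mono) (auto simp: W'_def)
      also have "\<dots> = a \<bullet> w - 1" using gt[OF True] True by (simp add: s_def W'_def)
      finally show ?thesis by (simp add: p)
    next
      case False
      then have "(1 - s z) * 1 + s z * 1 \<le> (1 - s z) * (a \<bullet> w) + s z * (v \<bullet> w)"
        using s01 a[OF w] w by (intro add_mono mult_left_mono) (auto simp: W'_def)
      then show ?thesis by (simp add: p algebra_simps)
    qed
    then have "dim (T p) \<le> dim (T a)" by (rule max)
    moreover have "p \<bullet> z = 1" using z gt[OF z] by (simp add: p s_def W'_def)
    then have "insert z (T a) \<subseteq> T p" using z v by (simp add: T_def W'_def p subset_iff)
    then have "dim (insert z (T a)) \<le> dim (T p)" by (rule dim_subset)
    \<comment> \<open>\<open>a - v\<close> vanishes on \<open>span (T a)\<close> but not at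
      \<open>z\<close>, so the new tight constraint raises the dimension.\<close>
    moreover have "z \<notin> span (T a)"
    proof
      assume "z \<in> span (T a)"
      then have "(a - v) \<bullet> z = 0"
        by (rule orthogonal_to_span[rotated]) (use v in \<open>auto simp: T_def inner_diff_left\<close>)
      then show False using z gt[OF z] by (simp add: W'_def inner_diff_left)
    qed
    ultimately show False by (simp add: dim_insert)
  qed
qed

text \<open>After scaling, \<open>tight_face_feasible\<close> reduces the inequalities to equations
  \<open>v \<bullet> b = 1\<close> for independent tight \<open>b\<close>. Replacing the value
  \<open>1\<close> by an unknown makes the system homogeneous, with \<open>CARD('n) + 1\<close>
  unknowns and at most \<open>CARD('n)\<close> equations, as Siegel's lemma requires.\<close>

lemma small_separator:
  fixes W :: "(int ^ 'n::finite) set" and a0 :: "real ^ 'n"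
  assumes W: "finite W" and H: "1 \<le> H" "\<And>w i. w \<in> W \<Longrightarrow> \<bar>w $ i\<bar> \<le> H"
    and a0: "\<And>w. w \<in> W \<Longrightarrow> 0 < a0 \<bullet> real_vec w"
  obtains c where "\<And>i. \<bar>c $ i\<bar> \<le> (2 * int (CARD('n) + 1) * H + 1) ^ CARD('n)"
    "\<And>w. w \<in> W \<Longrightarrow> 0 < int_inner c w"
proof -
  \<comment> \<open>The \<open>1\<close> keeps the minimum meaningful for empty
    \<open>W\<close>.\<close>
  define \<epsilon> where "\<epsilon> = Min (insert 1 ((\<lambda>w. a0 \<bullet> real_vec w) ` W))"
  have \<epsilon>: "0 < \<epsilon>" using W a0 by (simp add: \<epsilon>_def)
  have "1 \<le> (a0 /\<^sub>R \<epsilon>) \<bullet> w" if "w \<in> real_vec ` W" for w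
  proof -
    have "\<epsilon> \<le> a0 \<bullet> w" using that W unfolding \<epsilon>_def by (intro Min_le) auto
    then show ?thesis using \<epsilon> by (simp add: field_simps)
  qed
  then obtain a where a: "\<And>v w. \<lbrakk>\<And>u. u \<in> real_vec ` W \<Longrightarrow> a \<bullet> u = 1 \<Longrightarrow> v \<bullet> u = 1; w \<in> real_vec ` W\<rbrakk>
      \<Longrightarrow> 1 \<le> v \<bullet> w"
    using tight_face_feasible[of "real_vec ` W" "a0 /\<^sub>R \<epsilon>"] W by blast
  define T where "T = {u \<in> real_vec ` W. a \<bullet> u = 1}"
  obtain B where B: "B \<subseteq> T" "independent B" "T \<subseteq> span B"
    using maximal_independent_subset[of T] by blast
  \<comment> \<open>The added unit vectors \<open>b\<close> contribute the equations
    \<open>c \<bullet> b = 0\<close>. With them \<open>c\<close> is determined by its common value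
    on \<open>B\<close>, and \<open>1 \<le> H\<close> keeps their coefficients within the
    bound.\<close>
  obtain B' where B': "B \<subseteq> B'" "B' \<subseteq> B \<union> Basis" "independent B'" "B \<union> Basis \<subseteq> span B'"
    using maximal_independent_subset_extend[of B "B \<union> Basis"] B(2) by blast
  have span: "u \<in> span B'" for u
  proof -
    have "span Basis \<subseteq> span B'" using B'(4) by (intro span_minimal subspace_span) auto
    then show ?thesis by auto
  qed
  have "card B' \<le> CARD('n)" using independent_card_le_dim[of B' UNIV] B'(3) by simp
  then have card: "card B' < card (UNIV :: 'n option set)" "card B' \<le> CARD('n)" by simp_all
  have int: "real_of_int \<lfloor>b $ j\<rfloor> = b $ j" and bound: "\<bar>\<lfloor>b $ j\<rfloor>\<bar> \<le> H" if b: "b \<in> B'" for b j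
  proof -
    consider w where "w \<in> W" "b = real_vec w" | "b \<in> Basis"
      using b B'(2) B(1) unfolding T_def by blast
    then have "real_of_int \<lfloor>b $ j\<rfloor> = b $ j \<and> \<bar>\<lfloor>b $ j\<rfloor>\<bar> \<le> H"
    proof cases
      case (1 w)
      then show ?thesis using H(2)[of w j] by simp
    next
      case 2
      then obtain i where "b = axis i 1" by (auto simp: Basis_vec_def)
      then show ?thesis using H(1) by (cases "j = i") (simp_all add: axis_def)
    qed
    then show "real_of_int \<lfloor>b $ j\<rfloor> = b $ j" "\<bar>\<lfloor>b $ j\<rfloor>\<bar> \<le> H" by auto
  qed
  text \<open>The unknowns are the entries of the functional (\<open>Some\<close>) and its common value on \<open>B\<close>
    (\<open>None\<close>).\<close>
  define A where "A b j = (case j of None \<Rightarrow> if b \<in> B then - 1 else 0 | Some j \<Rightarrow> \<lfloor>b $ j\<rfloor>)"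
    for b :: "real ^ 'n" and j :: "'n option"
  have A_le: "\<bar>A b j\<bar> \<le> H" if "b \<in> B'" for b j
    using bound[OF that] H(1) by (cases j) (auto simp: A_def)
  have "0 \<le> H" using H(1) by simp
  from siegel[of B' UNIV H A, OF independent_imp_finite[OF B'(3)] finite card(1) this A_le]
  obtain x where "\<exists>j\<in>UNIV. x j \<noteq> 0"
    "\<forall>j\<in>UNIV. \<bar>x j\<bar> \<le> (2 * int CARD('n option) * H + 1) ^ card B'"
    "\<forall>b\<in>B'. (\<Sum>j\<in>UNIV. A b j * x j) = 0" by blast
  then have x: "\<exists>j. x j \<noteq> 0"
    "\<And>j. \<bar>x j\<bar> \<le> (2 * int (CARD('n) + 1) * H + 1) ^ card B'"
    "\<And>b. b \<in> B' \<Longrightarrow> (\<Sum>j\<in>UNIV. A b j * x j) = 0" by simp_all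
  define c where "c = (\<chi> j. x (Some j))"
  have c: "real_vec c \<bullet> b = (if b \<in> B then x None else 0)" if "b \<in> B'" for b
  proof -
    have "(\<Sum>j\<in>UNIV. \<lfloor>b $ j\<rfloor> * x (Some j)) = (if b \<in> B then x None else 0)"
      using x(3)[OF that] by (simp add: UNIV_option_conv sum.reindex A_def split: if_splits)
    from arg_cong[OF this, of real_of_int] show ?thesis
      by (simp add: inner_vec_def c_def int[OF that] mult.commute)
  qed
  \<comment> \<open>If the common value were \<open>0\<close>, \<open>c\<close> would vanish on a
    basis of the whole space, and the solution from Siegel's lemma would be zero.\<close>
  have t: "x None \<noteq> 0"
  proof
    assume 0: "x None = 0"
    have "real_vec c \<bullet> real_vec c = 0"
      by (rule orthogonal_to_span[OF _ span]) (use c 0 in auto)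
    then have "x (Some j) = 0" for j by (simp add: c_def vec_eq_iff)
    with 0 x(1) show False by (metis option.exhaust)
  qed
  \<comment> \<open>\<open>c\<close> divided by \<open>x None\<close> solves the tight equations;
    \<open>d\<close> is this quotient times \<open>|x None|\<close>, hence integral and with the
    same signs.\<close>
  define d where "d = (\<chi> j. sgn (x None) * c $ j)"
  define v where "v = real_vec d /\<^sub>R \<bar>x None\<bar>"
  have rd: "real_vec d = real_of_int (sgn (x None)) *\<^sub>R real_vec c"
    by (simp add: d_def vec_eq_iff)
  have vb: "v \<bullet> b = 1" if "b \<in> B" for b
    using c[of b] that B'(1) t by (auto simp: v_def rd sgn_if)
  have ab: "a \<bullet> b = 1" if "b \<in> B" for b using that B(1) by (auto simp: T_def)
  have vu: "v \<bullet> u = 1" if "u \<in> real_vec ` W" "a \<bullet> u = 1" for u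
  proof -
    have "(a - v) \<bullet> u = 0"
    proof (rule orthogonal_to_span)
      show "u \<in> span B" using that B(3) by (auto simp: T_def)
    qed (simp add: inner_diff_left vb ab)
    then show ?thesis using that(2) by (simp add: inner_diff_left)
  qed
  have "1 \<le> v \<bullet> w" if "w \<in> real_vec ` W" for w
    by (rule a[OF vu that])
  then have pos: "0 < int_inner d w" if "w \<in> W" for w
    using that t by (force simp: v_def inner_real_vec field_simps)
  show thesis
  proof (rule that[of d])
    fix i
    have "\<bar>d $ i\<bar> = \<bar>x (Some i)\<bar>" using t by (simp add: d_def c_def abs_mult sgn_if)
    also have "\<dots> \<le> (2 * int (CARD('n) + 1) * H + 1) ^ card B'" by (rule x(2))
    also have "\<dots> \<le> (2 * int (CARD('n) + 1) * H + 1) ^ CARD('n)"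
      using H(1) card(2) by (intro power_increasing) auto
    finally show "\<bar>d $ i\<bar> \<le> (2 * int (CARD('n) + 1) * H + 1) ^ CARD('n)" .
  qed (rule pos)
qed

section \<open>Arithmetic width by bounded search\<close>

lemma finite_int_box: "finite {x :: int ^ 'n::finite. \<forall>i. \<bar>x $ i\<bar> \<le> S}"
proof -
  have "finite (Pi\<^sub>E (UNIV :: 'n set) (\<lambda>_. {- S..S}))" by (intro finite_PiE) auto
  moreover have "vec_nth ` {x :: int ^ 'n. \<forall>i. \<bar>x $ i\<bar> \<le> S} \<subseteq> Pi\<^sub>E UNIV (\<lambda>_. {- S..S})"
    by (auto simp: abs_le_iff minus_le_iff)
  ultimately show ?thesis
    by (meson finite_imageD finite_subset inj_onI vec_nth_inject)
qed

lemma abs_int_inner_le: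
  fixes c x :: "int ^ 'n::finite"
  assumes "\<And>i. \<bar>c $ i\<bar> \<le> R" "\<And>i. \<bar>x $ i\<bar> \<le> S"
  shows "\<bar>int_inner c x\<bar> \<le> int CARD('n) * R * S"
proof -
  have "0 \<le> R" using assms(1) order_trans[OF abs_ge_zero] by blast
  have "\<bar>int_inner c x\<bar> \<le> (\<Sum>i\<in>UNIV. \<bar>c $ i * x $ i\<bar>)" unfolding int_inner_def by (rule sum_abs)
  also have "\<dots> \<le> (\<Sum>i\<in>(UNIV :: 'n set). R * S)"
    unfolding abs_mult using assms \<open>0 \<le> R\<close> by (intro sum_mono mult_mono) auto
  finally show ?thesis by (simp add: mult.assoc)
qed

lemma int_inner_diff_right: "int_inner c (x - y) = int_inner c x - int_inner c y"
  by (simp add: int_inner_def right_diff_distrib sum_subtractf)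

lemma lattice_points_eq: "lattice_points = range real_vec"
proof
  show "lattice_points \<subseteq> range real_vec"
  proof
    fix x :: "real ^ 'n" assume "x \<in> lattice_points"
    then have "x = real_vec (\<chi> i. \<lfloor>x $ i\<rfloor>)" by (auto simp: lattice_points_def vec_eq_iff elim!: Ints_cases)
    then show "x \<in> range real_vec" by blast
  qed
qed (auto simp: lattice_points_def)

lemma aw_dir_eq:
  fixes c :: "int ^ 'n::finite"
  assumes "c \<noteq> 0"
  shows "aw_dir c P = card (int_inner c ` {x. real_vec x \<in> P})"
proof -
  have mem: "x \<in> hyperplane c b \<longleftrightarrow> real_vec c \<bullet> x = b" for x b
    by (simp add: hyperplane_def real_vec_def)
  have "{H. (\<exists>b. H = hyperplane c b) \<and> H \<inter> (P \<inter> lattice_points) \<noteq> {}} =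
      (\<lambda>k. hyperplane c (real_of_int k)) ` int_inner c ` {x. real_vec x \<in> P}"
    by (auto simp: mem lattice_points_eq inner_real_vec intro!: imageI) (force simp: mem inner_real_vec)+
  \<comment> \<open>A hyperplane determines its level because it contains a multiple of the nonzero
    \<open>c\<close>.\<close>
  moreover have "inj (\<lambda>k. hyperplane c (real_of_int k))"
  proof (rule injI)
    fix k l assume eq: "hyperplane c (real_of_int k) = hyperplane c (real_of_int l)"
    define x where "x = (real_of_int k / (real_vec c \<bullet> real_vec c)) *\<^sub>R real_vec c"
    have "real_vec c \<bullet> x = real_of_int k" using assms by (simp add: x_def)
    with eq mem show "k = l" by (metis of_int_eq_iff)
  qed
  ultimately show ?thesis unfolding aw_dir_def by (simp add: card_image inj_on_subset)
qed

text \<open>Let \<open>c0\<close> be optimal. A small \<open>c\<close> orthogonal to all differences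
  of lattice points on a common level of \<open>c0\<close> is constant on each such level, so it
  takes no more values than \<open>c0\<close>. The factor \<open>2 * S\<close> bounds the entries of
  the differences.\<close>

lemma small_optimal_direction:
  fixes P :: "(real ^ 'n::finite) set"
  assumes S: "0 \<le> S" "\<And>x i. real_vec x \<in> P \<Longrightarrow> \<bar>x $ i\<bar> \<le> S"
  obtains c where "c \<noteq> 0" "\<And>i. \<bar>c $ i\<bar> \<le> (2 * int CARD('n) * (2 * S) + 1) ^ CARD('n)"
    "aw_dir c P = aw P"
proof -
  let ?X = "{x. real_vec x \<in> P}"
  have "axis undefined 1 \<in> UNIV - {0 :: int ^ 'n}" by (simp add: axis_eq_0_iff)
  then have "aw P \<in> (\<lambda>c. aw_dir c P) ` (UNIV - {0})"
    unfolding aw_def by (intro Inf_nat_def1) blast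
  then obtain c0 where "aw P = aw_dir c0 P" "c0 \<in> UNIV - {0}" by (rule imageE)
  then have c0: "c0 \<noteq> 0" "aw_dir c0 P = aw P" by simp_all
  define E where "E = {x - y |x y. x \<in> ?X \<and> y \<in> ?X \<and> int_inner c0 x = int_inner c0 y}"
  have "\<bar>z $ i\<bar> \<le> 2 * S" if z: "z \<in> E" for z i
  proof -
    obtain x y where "z = x - y" "real_vec x \<in> P" "real_vec y \<in> P" using z by (auto simp: E_def)
    then show ?thesis using S(2)[of x i] S(2)[of y i] by simp
  qed
  moreover have "int_inner c0 z = 0" if "z \<in> E" for z
    using that by (auto simp: E_def int_inner_diff_right)
  ultimately obtain c where c: "c \<noteq> 0"
    "\<And>i. \<bar>c $ i\<bar> \<le> (2 * int CARD('n) * (2 * S) + 1) ^ CARD('n)"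
    "\<And>z. z \<in> E \<Longrightarrow> int_inner c z = 0"
    using small_orthogonal[of "2 * S" E c0] S(1) c0(1) by (metis mult_nonneg_nonneg zero_le_numeral)
  have eq: "int_inner c x = int_inner c y"
    if "x \<in> ?X" "y \<in> ?X" "int_inner c0 x = int_inner c0 y" for x y
  proof -
    have "x - y \<in> E" using that unfolding E_def by blast
    from c(3)[OF this] show ?thesis by (simp add: int_inner_diff_right)
  qed
  have "finite ?X" using finite_int_box[of S] by (rule finite_subset[rotated]) (use S(2) in auto)
  then have fin: "finite (int_inner c0 ` ?X)" by simp
  have "int_inner c ` ?X = (\<lambda>k. int_inner c (inv_into ?X (int_inner c0) k)) ` int_inner c0 ` ?X"
    unfolding image_image
  proof (rule image_cong[OF refl])
    fix x assume x: "x \<in> ?X"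
    then have k: "int_inner c0 x \<in> int_inner c0 ` ?X" by (rule imageI)
    show "int_inner c x = int_inner c (inv_into ?X (int_inner c0) (int_inner c0 x))"
      by (rule eq[OF x inv_into_into[OF k]]) (simp add: f_inv_into_f[OF k])
  qed
  then have "card (int_inner c ` ?X) \<le> card (int_inner c0 ` ?X)" using card_image_le[OF fin] by metis
  then have "aw_dir c P \<le> aw P" using c0 c(1) by (simp add: aw_dir_eq)
  moreover have "aw P \<le> aw_dir c P"
    unfolding aw_def using c(1) by (intro cINF_lower) auto
  ultimately show thesis using that c by simp
qed

text \<open>The minimum of the counts is the number of \<open>k \<ge> 0\<close> below all of them,
  which a sum of truth values expresses. As \<open>V\<close> bounds \<open>int_inner c x\<close>, at
  most \<open>2 * V + 1\<close> values occur, and \<open>{0..<2 * V + 2}\<close> contains every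
  \<open>k\<close> that counts.\<close>

lemma aw_bounded_search:
  fixes P :: "(real ^ 'n::finite) set"
  assumes S: "0 \<le> S" "\<And>x i. real_vec x \<in> P \<Longrightarrow> \<bar>x $ i\<bar> \<le> S"
    and R: "(2 * int CARD('n) * (2 * S) + 1) ^ CARD('n) \<le> R"
    and V: "V = int CARD('n) * R * S"
  shows "(\<Sum>k\<in>{0..<2 * V + 2}. of_bool (\<forall>c :: int ^ 'n. (\<forall>i. \<bar>c $ i\<bar> \<le> R) \<longrightarrow> c \<noteq> 0 \<longrightarrow>
    k < (\<Sum>v\<in>{- V..<V + 1}. of_bool (\<exists>x. real_vec x \<in> P \<and> int_inner c x = v)))) = int (aw P)"
proof -
  let ?X = "{x. real_vec x \<in> P}"
  have "1 \<le> (2 * int CARD('n) * (2 * S) + 1) ^ CARD('n)" using S(1) by (intro one_le_power) simp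
  then have "0 \<le> R" using R by linarith
  then have "0 \<le> V" using S(1) V by simp
  have count: "(\<Sum>v\<in>{- V..<V + 1}. of_bool (\<exists>x. real_vec x \<in> P \<and> int_inner c x = v)) = int (aw_dir c P)"
    if c: "\<forall>i. \<bar>c $ i\<bar> \<le> R" "c \<noteq> 0" for c :: "int ^ 'n"
  proof -
    have "\<bar>int_inner c x\<bar> \<le> V" if "x \<in> ?X" for x
      unfolding V using c(1) S(2) that by (intro abs_int_inner_le) auto
    then have "{v \<in> {- V..<V + 1}. \<exists>x. real_vec x \<in> P \<and> int_inner c x = v} = int_inner c ` ?X"
      by (force simp: abs_le_iff)
    then show ?thesis using c(2) by (simp add: aw_dir_eq sum.inter_filter[symmetric] of_bool_def)
  qed
  obtain c1 where c1: "c1 \<noteq> 0" "\<And>i. \<bar>c1 $ i\<bar> \<le> R" "aw_dir c1 P = aw P"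
    using small_optimal_direction[OF S] R order_trans by metis
  have le: "aw P \<le> aw_dir c P" if "c \<noteq> 0" for c
    unfolding aw_def using that by (intro cINF_lower) auto
  have "int (aw P) = (\<Sum>v\<in>{- V..<V + 1}. of_bool (\<exists>x. real_vec x \<in> P \<and> int_inner c1 x = v))"
    using count[of c1] c1 by simp
  also have "\<dots> \<le> (\<Sum>v\<in>{- V..<V + 1}. 1)" by (intro sum_mono) simp
  finally have aw_le: "int (aw P) \<le> 2 * V + 1" using \<open>0 \<le> V\<close> by simp
  have "(\<forall>c :: int ^ 'n. (\<forall>i. \<bar>c $ i\<bar> \<le> R) \<longrightarrow> c \<noteq> 0 \<longrightarrow>
      k < (\<Sum>v\<in>{- V..<V + 1}. of_bool (\<exists>x. real_vec x \<in> P \<and> int_inner c x = v))) \<longleftrightarrow> k < int (aw P)" for k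
  proof
    assume "\<forall>c :: int ^ 'n. (\<forall>i. \<bar>c $ i\<bar> \<le> R) \<longrightarrow> c \<noteq> 0 \<longrightarrow>
      k < (\<Sum>v\<in>{- V..<V + 1}. of_bool (\<exists>x. real_vec x \<in> P \<and> int_inner c x = v))"
    with c1(1,2) have "k < (\<Sum>v\<in>{- V..<V + 1}. of_bool (\<exists>x. real_vec x \<in> P \<and> int_inner c1 x = v))"
      by blast
    then show "k < int (aw P)" using count[of c1] c1 by simp
  next
    assume k: "k < int (aw P)"
    show "\<forall>c :: int ^ 'n. (\<forall>i. \<bar>c $ i\<bar> \<le> R) \<longrightarrow> c \<noteq> 0 \<longrightarrow>
      k < (\<Sum>v\<in>{- V..<V + 1}. of_bool (\<exists>x. real_vec x \<in> P \<and> int_inner c x = v))"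
    proof (intro allI impI)
      fix c :: "int ^ 'n" assume c: "\<forall>i. \<bar>c $ i\<bar> \<le> R" "c \<noteq> 0"
      have "k < int (aw_dir c P)" using k le[OF c(2)] by linarith
      then show "k < (\<Sum>v\<in>{- V..<V + 1}. of_bool (\<exists>x. real_vec x \<in> P \<and> int_inner c x = v))"
        unfolding count[OF c] .
    qed
  qed
  moreover have "{k \<in> {0..<2 * V + 2}. k < int (aw P)} = {0..<int (aw P)}" using aw_le by auto
  ultimately show ?thesis by (simp add: sum.inter_filter[symmetric] of_bool_def)
qed


section \<open>Membership in a rational polytope\<close>

definition numerator :: "rat \<Rightarrow> int" where "numerator r = fst (quotient_of r)"

definition denominator :: "rat \<Rightarrow> int" where "denominator r = snd (quotient_of r)"

lemma denominator_pos: "0 < denominator r"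
  by (simp add: denominator_def quotient_of_denom_pos')

lemma of_rat_quotient: "(of_rat r :: real) = of_int (numerator r) / of_int (denominator r)"
proof -
  have "r = of_int (numerator r) / of_int (denominator r)"
    by (rule quotient_of_div) (simp add: numerator_def denominator_def)
  then show ?thesis by (metis of_rat_divide of_rat_of_int_eq)
qed

text \<open>The difference of the integer point \<open>x\<close> and the point with coordinates \<open>a j / q j\<close>, multiplied
  by the product of all \<open>q j\<close>.\<close>

definition scaled_diff :: "('n \<Rightarrow> int) \<Rightarrow> ('n \<Rightarrow> int) \<Rightarrow> int ^ 'n \<Rightarrow> int ^ 'n::finite" where
  "scaled_diff a q x = (\<chi> j. (x $ j * q j - a j) * (\<Prod>k\<in>UNIV - {j}. q k))"

lemma real_vec_scaled_diff:
  assumes "\<And>j. 0 < q j"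
  shows "real_vec (scaled_diff a q x) =
    real_of_int (\<Prod>k\<in>UNIV. q k) *\<^sub>R (real_vec x - (\<chi> j. real_of_int (a j) / real_of_int (q j)))"
proof -
  have "real_vec (scaled_diff a q x) $ j = (real_of_int (\<Prod>k\<in>UNIV. q k) *\<^sub>R
      (real_vec x - (\<chi> j. real_of_int (a j) / real_of_int (q j)))) $ j" for j
  proof -
    have "real_of_int (\<Prod>k\<in>UNIV. q k) = of_int (q j) * of_int (\<Prod>k\<in>UNIV - {j}. q k)"
      by (simp only: prod.remove[OF finite UNIV_I, of q j] of_int_mult)
    moreover have "q j \<noteq> 0" using assms[of j] by simp
    ultimately show ?thesis by (simp add: scaled_diff_def field_simps del: of_int_prod)
  qed
  then show ?thesis by (simp add: vec_eq_iff)
qed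

lemma abs_scaled_diff_le:
  fixes x :: "int ^ 'n::finite"
  assumes "1 \<le> S" "\<And>j. \<bar>a j\<bar> \<le> S" "\<And>j. \<bar>q j\<bar> \<le> S" "\<And>j. \<bar>x $ j\<bar> \<le> S"
  shows "\<bar>scaled_diff a q x $ j\<bar> \<le> 2 * S ^ (CARD('n) + 1)"
proof -
  have "\<bar>x $ j * q j - a j\<bar> \<le> \<bar>x $ j\<bar> * \<bar>q j\<bar> + \<bar>a j\<bar>"
    by (metis abs_mult abs_triangle_ineq4)
  also have "\<dots> \<le> S * S + S * S"
  proof (rule add_mono)
    show "\<bar>x $ j\<bar> * \<bar>q j\<bar> \<le> S * S" using assms by (intro mult_mono) auto
    have "\<bar>a j\<bar> \<le> S * 1" using assms by simp
    also have "\<dots> \<le> S * S" using assms(1) by (intro mult_left_mono) auto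
    finally show "\<bar>a j\<bar> \<le> S * S" .
  qed
  finally have 1: "\<bar>x $ j * q j - a j\<bar> \<le> 2 * S ^ 2" by (simp add: power2_eq_square)
  have "\<bar>\<Prod>k\<in>UNIV - {j}. q k\<bar> = (\<Prod>k\<in>UNIV - {j}. \<bar>q k\<bar>)" by (rule abs_prod)
  also have "\<dots> \<le> (\<Prod>k\<in>UNIV - {j}. S)" using assms by (intro prod_mono) auto
  also have "\<dots> = S ^ (CARD('n) - 1)" by (simp add: card_Diff_singleton)
  finally have "\<bar>scaled_diff a q x $ j\<bar> \<le> 2 * S ^ 2 * S ^ (CARD('n) - 1)"
    unfolding scaled_diff_def using 1 by (auto simp: abs_mult intro!: mult_mono)
  also have "\<dots> = 2 * S ^ (2 + (CARD('n) - 1))" by (simp only: power_add mult.assoc)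
  also have "2 + (CARD('n) - 1) = CARD('n) + 1" using zero_less_card_finite[where 'a = 'n] by linarith
  finally show ?thesis .
qed

abbreviation point_diff :: "rat ^ 'n \<Rightarrow> int ^ 'n \<Rightarrow> int ^ 'n::finite" where
  "point_diff p \<equiv> scaled_diff (\<lambda>j. numerator (p $ j)) (\<lambda>j. denominator (p $ j))"

text \<open>Clearing denominators multiplies by a positive integer, so the sign survives.\<close>

lemma inner_point_diff_pos_iff:
  "0 < v \<bullet> real_vec (point_diff p x) \<longleftrightarrow> v \<bullet> (\<chi> i. of_rat (p $ i)) < v \<bullet> real_vec x"
proof -
  have "real_vec (point_diff p x) =
      real_of_int (\<Prod>k\<in>UNIV. denominator (p $ k)) *\<^sub>R (real_vec x - (\<chi> i. of_rat (p $ i)))"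
    by (simp add: real_vec_scaled_diff denominator_pos of_rat_quotient)
  moreover have "0 < (\<Prod>k\<in>UNIV. denominator (p $ k))" by (intro prod_pos) (simp add: denominator_pos)
  ultimately show ?thesis by (simp add: inner_diff_right zero_less_mult_iff del: of_int_prod)
qed

text \<open>Denominators are at least \<open>1\<close>, so the numerators alone bound the generating
  points, and the box around these is convex.\<close>

lemma rat_polytope_bound:
  assumes S: "\<And>p j. p \<in> set ps \<Longrightarrow> \<bar>numerator (p $ j)\<bar> \<le> S" and x: "real_vec x \<in> rat_polytope ps"
  shows "\<bar>x $ j\<bar> \<le> S"
proof -
  have "rat_polytope ps \<subseteq> {y. \<forall>i. \<bar>y $ i\<bar> \<le> real_of_int S}"
    unfolding rat_polytope_def
  proof (rule hull_minimal)
    have "{y :: real ^ 'a. \<forall>i. \<bar>y $ i\<bar> \<le> real_of_int S} = cbox (\<chi> i. - of_int S) (\<chi> i. of_int S)"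
      by (auto simp: mem_box_cart abs_le_iff minus_le_iff)
    then show "convex {y :: real ^ 'a. \<forall>i. \<bar>y $ i\<bar> \<le> real_of_int S}" by (simp add: convex_box)
    have "\<bar>of_rat (p $ i) :: real\<bar> \<le> real_of_int S" if "p \<in> set ps" for p i
    proof -
      have "1 \<le> denominator (p $ i)" using denominator_pos[of "p $ i"] by simp
      then have "\<bar>of_rat (p $ i) :: real\<bar> \<le> \<bar>of_int (numerator (p $ i))\<bar>"
        unfolding of_rat_quotient abs_divide by (simp add: divide_le_eq mult_le_cancel_left1)
      also have "\<dots> \<le> real_of_int S" using S[OF that, of i] by linarith
      finally show ?thesis .
    qed
    then show "(\<lambda>p. \<chi> i. of_rat (p $ i)) ` set ps \<subseteq> {y. \<forall>i. \<bar>y $ i\<bar> \<le> real_of_int S}" by auto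
  qed
  then have "\<bar>real_vec x $ j\<bar> \<le> real_of_int S" using x by blast
  then show ?thesis by simp
qed

text \<open>\<open>R\<close> is the bound of \<open>small_separator\<close> for
  \<open>H = 2 * S ^ (CARD('n) + 1)\<close>, the size of the scaled differences. Conversely, such a
  \<open>c\<close> puts the generating points, hence their hull, into an open half-space with
  \<open>x\<close> on its boundary.\<close>

lemma not_in_rat_polytope_iff:
  fixes ps :: "(rat ^ 'n::finite) list"
  assumes S: "1 \<le> S" "\<And>p j. p \<in> set ps \<Longrightarrow> \<bar>numerator (p $ j)\<bar> \<le> S"
      "\<And>p j. p \<in> set ps \<Longrightarrow> \<bar>denominator (p $ j)\<bar> \<le> S" "\<And>j. \<bar>x $ j\<bar> \<le> S"
    and R: "R = (2 * int (CARD('n) + 1) * (2 * S ^ (CARD('n) + 1)) + 1) ^ CARD('n)"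
  shows "real_vec x \<notin> rat_polytope ps \<longleftrightarrow>
    (\<exists>c. (\<forall>i. \<bar>c $ i\<bar> \<le> R) \<and> (\<forall>p\<in>set ps. 0 < int_inner c (point_diff p x)))"
proof
  assume notin: "real_vec x \<notin> rat_polytope ps"
  have "closed (rat_polytope ps)" unfolding rat_polytope_def
    by (intro compact_imp_closed compact_convex_hull finite_imp_compact) simp
  then obtain a b where ab: "a \<bullet> real_vec x < b" "\<And>y. y \<in> rat_polytope ps \<Longrightarrow> b < a \<bullet> y"
    using separating_hyperplane_closed_point[OF _ _ notin] by (auto simp: rat_polytope_def)
  \<comment> \<open>The differences point from the polytope to \<open>x\<close>, hence the
    sign.\<close>
  have "0 < (- a) \<bullet> real_vec (point_diff p x)" if "p \<in> set ps" for p
  proof -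
    have "(\<chi> i. of_rat (p $ i)) \<in> rat_polytope ps"
      unfolding rat_polytope_def using that by (intro hull_inc imageI)
    then show ?thesis unfolding inner_point_diff_pos_iff using ab by fastforce
  qed
  then have pos: "0 < (- a) \<bullet> real_vec w" if "w \<in> (\<lambda>p. point_diff p x) ` set ps" for w using that by auto
  have bound: "\<bar>w $ i\<bar> \<le> 2 * S ^ (CARD('n) + 1)" if w: "w \<in> (\<lambda>p. point_diff p x) ` set ps" for w i
  proof -
    obtain p where p: "p \<in> set ps" "w = point_diff p x" using w by blast
    show ?thesis
      unfolding p(2) by (rule abs_scaled_diff_le[OF S(1) S(2)[OF p(1)] S(3)[OF p(1)] S(4)])
  qed
  have "1 \<le> 2 * S ^ (CARD('n) + 1)" using one_le_power[OF S(1), of "CARD('n) + 1"] by linarith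
  from small_separator[OF _ this bound pos]
  obtain c where "\<And>i. \<bar>c $ i\<bar> \<le> R" "\<And>w. w \<in> (\<lambda>p. point_diff p x) ` set ps \<Longrightarrow> 0 < int_inner c w"
    unfolding R by blast
  then show "\<exists>c. (\<forall>i. \<bar>c $ i\<bar> \<le> R) \<and> (\<forall>p\<in>set ps. 0 < int_inner c (point_diff p x))" by blast
next
  assume "\<exists>c. (\<forall>i. \<bar>c $ i\<bar> \<le> R) \<and> (\<forall>p\<in>set ps. 0 < int_inner c (point_diff p x))"
  then obtain c where c: "\<And>p. p \<in> set ps \<Longrightarrow> 0 < int_inner c (point_diff p x)" by blast
  have "rat_polytope ps \<subseteq> {y. real_vec c \<bullet> y < real_vec c \<bullet> real_vec x}"
    unfolding rat_polytope_def
  proof (rule hull_minimal)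
    have "real_vec c \<bullet> (\<chi> i. of_rat (p $ i)) < real_vec c \<bullet> real_vec x" if "p \<in> set ps" for p
    proof -
      have "0 < real_vec c \<bullet> real_vec (point_diff p x)" unfolding inner_real_vec using c[OF that] by simp
      then show ?thesis by (simp only: inner_point_diff_pos_iff)
    qed
    then show "(\<lambda>p. \<chi> i. of_rat (p $ i)) ` set ps \<subseteq> {y. real_vec c \<bullet> y < real_vec c \<bullet> real_vec x}"
      by auto
  qed (rule convex_halfspace_lt)
  then show "real_vec x \<notin> rat_polytope ps" by auto
qed

section \<open>Search over integer vectors\<close>

text \<open>The position of an index in the increasing order that \<open>encode_point\<close> uses;
  it addresses both array cells and register blocks.\<close>

definition coord :: "'n::{finite,linorder} \<Rightarrow> nat" where
  "coord = inv_into {..<CARD('n)} (\<lambda>k. sorted_list_of_set UNIV ! k)"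

lemma bij_betw_sorted_list_nth:
  "bij_betw (\<lambda>k. sorted_list_of_set UNIV ! k) {..<CARD('n)} (UNIV :: 'n::{finite,linorder} set)"
  by (rule bij_betw_nth) simp_all

lemma coord_less: "coord (i :: 'n::{finite,linorder}) < CARD('n)"
  and nth_coord: "sorted_list_of_set UNIV ! coord i = i"
  using inv_into_into[of i "(\<lambda>k. sorted_list_of_set UNIV ! k)" "{..<CARD('n)}"]
    f_inv_into_f[of i "(\<lambda>k. sorted_list_of_set UNIV ! k)" "{..<CARD('n)}"]
    bij_betw_imp_surj_on[OF bij_betw_sorted_list_nth[where 'n = 'n]]
  unfolding coord_def by simp_all

definition vec_at :: "nat \<Rightarrow> (nat \<Rightarrow> int) \<Rightarrow> int ^ 'n::{finite,linorder}" where
  "vec_at b \<rho> = (\<chi> i. \<rho> (b + coord i))"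

lemma vec_at_cong:
  assumes "\<And>i. b \<le> i \<Longrightarrow> i < b + CARD('n) \<Longrightarrow> \<rho> i = \<rho>' i"
  shows "(vec_at b \<rho> :: int ^ 'n::{finite,linorder}) = vec_at b \<rho>'"
  using assms by (simp add: vec_at_def vec_eq_iff coord_less)

lemma feasible_vec_at_nth: "feasible (\<lambda>\<rho> m. vec_at b \<rho> $ i)"
  by (simp add: vec_at_def feasible_reg)

text \<open>\<open>cong\<close> is a freshness condition: \<open>Q\<close> reads the block at
  \<open>b\<close> only through its vector argument, so the search may overwrite that block.\<close>

lemma decidable_Ex_vec:
  fixes Q :: "(nat \<Rightarrow> int) \<Rightarrow> (int \<Rightarrow> int) \<Rightarrow> int ^ 'n::{finite,linorder} \<Rightarrow> bool"
  assumes R: "feasible (\<lambda>_. R)" and Q: "decidable (\<lambda>\<rho> m. Q \<rho> m (vec_at b \<rho>))"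
    and cong: "\<And>\<rho> \<rho>' m c. (\<And>i. i \<notin> {b..<b + CARD('n)} \<Longrightarrow> \<rho> i = \<rho>' i) \<Longrightarrow> Q \<rho> m c = Q \<rho>' m c"
  shows "decidable (\<lambda>\<rho> m. \<exists>c. (\<forall>i. \<bar>c $ i\<bar> \<le> R m) \<and> Q \<rho> m c)"
proof -
  let ?A = "{b..<b + CARD('n)}"
  have "(\<exists>\<rho>'. (\<forall>i. i \<notin> ?A \<longrightarrow> \<rho>' i = \<rho> i) \<and> (\<forall>i\<in>?A. \<bar>\<rho>' i\<bar> \<le> R m) \<and> Q \<rho>' m (vec_at b \<rho>')) \<longleftrightarrow>
      (\<exists>c. (\<forall>i. \<bar>c $ i\<bar> \<le> R m) \<and> Q \<rho> m c)" for \<rho> m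
  proof
    assume "\<exists>\<rho>'. (\<forall>i. i \<notin> ?A \<longrightarrow> \<rho>' i = \<rho> i) \<and> (\<forall>i\<in>?A. \<bar>\<rho>' i\<bar> \<le> R m) \<and> Q \<rho>' m (vec_at b \<rho>')"
    then obtain \<rho>' where \<rho>': "\<And>i. i \<notin> ?A \<Longrightarrow> \<rho>' i = \<rho> i" "\<And>i. i \<in> ?A \<Longrightarrow> \<bar>\<rho>' i\<bar> \<le> R m"
      "Q \<rho>' m (vec_at b \<rho>')" by blast
    have "Q \<rho> m (vec_at b \<rho>')" using cong[OF \<rho>'(1)] \<rho>'(3) by simp
    moreover have "\<bar>vec_at b \<rho>' $ i\<bar> \<le> R m" for i :: 'n
      using \<rho>'(2)[of "b + coord i"] coord_less[of i] by (simp add: vec_at_def)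
    ultimately show "\<exists>c. (\<forall>i. \<bar>c $ i\<bar> \<le> R m) \<and> Q \<rho> m c" by blast
  next
    assume "\<exists>c. (\<forall>i. \<bar>c $ i\<bar> \<le> R m) \<and> Q \<rho> m c"
    then obtain c where c: "\<And>i. \<bar>c $ i\<bar> \<le> R m" "Q \<rho> m c" by blast
    define \<rho>' where "\<rho>' i = (if i \<in> ?A then c $ (sorted_list_of_set UNIV ! (i - b)) else \<rho> i)" for i
    have "vec_at b \<rho>' = c" by (simp add: vec_at_def \<rho>'_def vec_eq_iff coord_less nth_coord)
    moreover have "Q \<rho>' m c = Q \<rho> m c" by (rule cong) (auto simp: \<rho>'_def)
    ultimately show "\<exists>\<rho>'. (\<forall>i. i \<notin> ?A \<longrightarrow> \<rho>' i = \<rho> i) \<and> (\<forall>i\<in>?A. \<bar>\<rho>' i\<bar> \<le> R m) \<and> Q \<rho>' m (vec_at b \<rho>')"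
      using c by (intro exI[of _ \<rho>']) (simp add: \<rho>'_def)
  qed
  then show ?thesis using decidable_Ex_registers[of ?A R, OF _ R Q] by simp
qed


section \<open>The input in memory\<close>

lemma nth_concat_uniform:
  assumes "\<And>xs. xs \<in> set xss \<Longrightarrow> length xs = l" "i < length xss" "k < l"
  shows "concat xss ! (l * i + k) = xss ! i ! k"
  using assms
proof (induction xss arbitrary: i)
  case (Cons xs xss)
  then show ?case by (cases i) (auto simp: nth_append)
qed simp

lemma length_concat_uniform:
  "(\<And>xs. xs \<in> set xss \<Longrightarrow> length xs = l) \<Longrightarrow> length (concat xss) = l * length xss"
  by (induction xss) auto

lemma length_encode_point: "length (encode_point (p :: rat ^ 'n::{finite,linorder})) = 2 * CARD('n)"
  unfolding encode_point_def by (subst length_concat_uniform[of _ 2]) (auto simp: encode_rat_def)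

lemma encode_point_nth:
  assumes "k < 2"
  shows "encode_point p ! (2 * coord j + k) = encode_rat (p $ j) ! k"
  unfolding encode_point_def
  by (subst nth_concat_uniform) (use assms in \<open>auto simp: encode_rat_def coord_less nth_coord\<close>)

lemma length_encode:
  "length (encode (ps :: (rat ^ 'n::{finite,linorder}) list)) = 1 + 2 * CARD('n) * length ps"
proof -
  have "length (concat (map encode_point ps)) = 2 * CARD('n) * length (map encode_point ps)"
    by (rule length_concat_uniform) (auto simp: length_encode_point)
  then show ?thesis by (simp add: encode_def)
qed

lemma encode_nth:
  fixes ps :: "(rat ^ 'n::{finite,linorder}) list"
  assumes "i < length ps" "k < 2"
  shows "encode ps ! (1 + (2 * CARD('n) * i + (2 * coord j + k))) = encode_rat (ps ! i $ j) ! k"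
proof -
  have "concat (map encode_point ps) ! (2 * CARD('n) * i + (2 * coord j + k)) =
      map encode_point ps ! i ! (2 * coord j + k)"
    using assms coord_less[of j] by (intro nth_concat_uniform) (auto simp: length_encode_point)
  then show ?thesis using assms by (simp add: encode_def encode_point_nth)
qed

lemma initial_memory_nth: "i < length xs \<Longrightarrow> snd (initial_state xs) (int i) = xs ! i"
  by (simp add: initial_state_def)

text \<open>Cell \<open>0\<close> holds the number of points; a point takes
  \<open>2 * CARD('n)\<close> cells, two for each coordinate with the numerator first.\<close>

definition input_numerator :: "(int \<Rightarrow> int) \<Rightarrow> int \<Rightarrow> 'n::{finite,linorder} \<Rightarrow> int" where
  "input_numerator m i j = m (1 + 2 * int CARD('n) * i + 2 * int (coord j))"

definition input_denominator :: "(int \<Rightarrow> int) \<Rightarrow> int \<Rightarrow> 'n::{finite,linorder} \<Rightarrow> int" where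
  "input_denominator m i j = m (2 + 2 * int CARD('n) * i + 2 * int (coord j))"

lemma input_entries:
  fixes ps :: "(rat ^ 'n::{finite,linorder}) list" and j :: 'n
  assumes m: "m = snd (initial_state (encode ps))" and i: "i < length ps"
  shows "input_numerator m (int i) j = numerator (ps ! i $ j)"
    and "input_denominator m (int i) j = denominator (ps ! i $ j)"
proof -
  have "m (1 + 2 * int CARD('n) * int i + 2 * int (coord j) + int k) = encode_rat (ps ! i $ j) ! k"
    if k: "k < 2" for k
  proof -
    let ?a = "1 + (2 * CARD('n) * i + (2 * coord j + k))"
    have "2 * coord j + k < 2 * CARD('n)" using coord_less[of j] k by linarith
    then have "?a < 1 + 2 * CARD('n) * Suc i" by simp
    also have "\<dots> \<le> 1 + 2 * CARD('n) * length ps" using i by (intro add_left_mono mult_left_mono) auto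
    finally have "?a < length (encode ps)" unfolding length_encode .
    then have "m (int ?a) = encode ps ! ?a" unfolding m by (rule initial_memory_nth)
    also have "\<dots> = encode_rat (ps ! i $ j) ! k" by (rule encode_nth[OF i k])
    finally show ?thesis by (simp add: algebra_simps)
  qed
  from this[of 0] this[of 1]
  show "input_numerator m (int i) j = numerator (ps ! i $ j)"
    "input_denominator m (int i) j = denominator (ps ! i $ j)"
    by (simp_all add: input_numerator_def input_denominator_def numerator_def denominator_def
        encode_rat_def algebra_simps)
qed

lemma bit_size_pos: "1 \<le> bit_size ps"
  by (simp add: bit_size_def encode_def int_bits_def)

text \<open>This provides \<open>B = 2 ^ L\<close>: every single entry has at most \<open>L\<close>
  bits, and cells outside the input are \<open>0\<close>.\<close>

lemma input_le_bit_size: "nat \<bar>snd (initial_state (encode ps)) a\<bar> \<le> 2 ^ bit_size ps"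
proof -
  have le: "nat \<bar>k\<bar> \<le> 2 ^ bit_size ps" if "k \<in> set (encode ps)" for k
  proof -
    have "\<bar>k\<bar> < 2 ^ nat (bitlen \<bar>k\<bar>)" using bitlen_bounds[of "\<bar>k\<bar>"] by (cases "k = 0") auto
    also have "\<dots> \<le> 2 ^ bit_size ps"
    proof (rule power_increasing)
      have "int_bits k \<le> bit_size ps"
        unfolding bit_size_def using that by (intro member_le_sum_list) auto
      then show "nat (bitlen \<bar>k\<bar>) \<le> bit_size ps" by (simp add: int_bits_def)
    qed simp
    finally show ?thesis by (simp add: nat_le_iff)
  qed
  show ?thesis
  proof (cases "0 \<le> a \<and> a < int (length (encode ps))")
    case True
    then have "snd (initial_state (encode ps)) a = encode ps ! nat a" by (simp add: initial_state_def)
    moreover have "nat a < length (encode ps)" using True by linarith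
    ultimately show ?thesis using le[OF nth_mem] by simp
  qed (auto simp: initial_state_def)
qed

section \<open>The arithmetic width as a feasible function\<close>

text \<open>The type of a memory does not show the dimension; fixing \<open>'n\<close> makes
  \<open>CARD('n)\<close> available to the constants below.\<close>

context
  fixes dim :: "'n::{finite,linorder} itself"
begin

text \<open>A sum of squares in place of a maximum of absolute values stays within ring operations
  and summation; the absolute value of an integer is at most its square. The range is the length of
  an encoded input.\<close>

definition input_bound :: "(int \<Rightarrow> int) \<Rightarrow> int" where
  "input_bound m = 1 + (\<Sum>a\<in>{0..<1 + 2 * int CARD('n) * m 0}. m a * m a)"

text \<open>The bound of \<open>not_in_rat_polytope_iff\<close> for
  \<open>S = input_bound m\<close>. It also dominates the bound on directions in
  \<open>small_optimal_direction\<close>, so one radius serves both searches.\<close>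

definition search_bound :: "(int \<Rightarrow> int) \<Rightarrow> int" where
  "search_bound m = (2 * int (CARD('n) + 1) * (2 * input_bound m ^ (CARD('n) + 1)) + 1) ^ CARD('n)"

definition value_bound :: "(int \<Rightarrow> int) \<Rightarrow> int" where
  "value_bound m = int CARD('n) * search_bound m * input_bound m"

definition separated :: "(int \<Rightarrow> int) \<Rightarrow> (int, 'n) vec \<Rightarrow> bool" where
  "separated m x \<longleftrightarrow> (\<exists>e. (\<forall>i. \<bar>e $ i\<bar> \<le> search_bound m) \<and> (\<forall>i\<in>{0..<m 0}.
    0 < int_inner e (scaled_diff (input_numerator m i) (input_denominator m i) x)))"

text \<open>For an encoded input the box contains all lattice points of the polytope, and for the
  points in it \<open>separated\<close> is equivalent to non-membership.\<close>

definition count_values :: "(int \<Rightarrow> int) \<Rightarrow> (int, 'n) vec \<Rightarrow> int" where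
  "count_values m c = (\<Sum>v\<in>{- value_bound m..<value_bound m + 1}. of_bool
    (\<exists>x. (\<forall>i. \<bar>x $ i\<bar> \<le> input_bound m) \<and> \<not> separated m x \<and> int_inner c x = v))"

definition width_search :: "(int \<Rightarrow> int) \<Rightarrow> int" where
  "width_search m = (\<Sum>k\<in>{0..<2 * value_bound m + 2}. of_bool
    (\<forall>c. (\<forall>i. \<bar>c $ i\<bar> \<le> search_bound m) \<longrightarrow> c \<noteq> 0 \<longrightarrow> k < count_values m c))"

lemma feasible_input_bound: "feasible (\<lambda>_. input_bound)"
  unfolding input_bound_def
  by (intro feasible_add feasible_const feasible_sum_var[where v = 0] feasible_mult feasible_load
      feasible_reg) simp

lemma feasible_search_bound: "feasible (\<lambda>_. search_bound)"
  unfolding search_bound_def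
  by (intro feasible_add feasible_const feasible_mult feasible_power feasible_input_bound)

lemma feasible_value_bound: "feasible (\<lambda>_. value_bound)"
  unfolding value_bound_def
  by (intro feasible_const feasible_mult feasible_search_bound feasible_input_bound)

lemma feasible_int_inner:
  fixes f g :: "(int, 'n) vec valuation"
  assumes "\<And>i. feasible (\<lambda>\<rho> m. f \<rho> m $ i)" "\<And>i. feasible (\<lambda>\<rho> m. g \<rho> m $ i)"
  shows "feasible (\<lambda>\<rho> m. int_inner (f \<rho> m) (g \<rho> m))"
  unfolding int_inner_def by (intro feasible_finite_sum feasible_mult assms finite)

lemma feasible_scaled_diff:
  fixes f :: "(int, 'n) vec valuation"
  assumes "\<And>i. feasible (\<lambda>\<rho> m. f \<rho> m $ i)" "feasible g"
  shows "feasible (\<lambda>\<rho> m. scaled_diff (input_numerator m (g \<rho> m)) (input_denominator m (g \<rho> m)) (f \<rho> m) $ i)"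
  unfolding scaled_diff_def input_numerator_def input_denominator_def vec_lambda_beta
  by (intro feasible_mult feasible_diff feasible_finite_prod feasible_load feasible_add feasible_const
      assms finite)

text \<open>Registers: the candidate functional \<open>e\<close> occupies \<open>0..<d\<close>, the point \<open>x\<close> occupies \<open>d..<2d\<close>,
  the direction \<open>c\<close> occupies \<open>2d..<3d\<close>.\<close>

lemma decidable_separated: "decidable (\<lambda>\<rho> m. separated m (vec_at CARD('n) \<rho>))"
  unfolding separated_def
proof (rule decidable_Ex_vec[where b = 0, OF feasible_search_bound])
  show "decidable (\<lambda>\<rho> m. \<forall>i\<in>{0..<m 0}. 0 < int_inner (vec_at 0 \<rho>)
      (scaled_diff (input_numerator m i) (input_denominator m i) (vec_at CARD('n) \<rho> :: (int, 'n) vec)))"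
  proof (rule decidable_Ball_var[where v = "3 * CARD('n)"])
    show "decidable (\<lambda>\<rho> m. 0 < int_inner (vec_at 0 \<rho>) (scaled_diff (input_numerator m (\<rho> (3 * CARD('n))))
        (input_denominator m (\<rho> (3 * CARD('n)))) (vec_at CARD('n) \<rho> :: (int, 'n) vec)))"
      by (intro decidable_less feasible_const feasible_int_inner feasible_scaled_diff
          feasible_vec_at_nth feasible_reg)
    fix \<rho> m a b
    have "vec_at 0 (\<rho>(3 * CARD('n) := b)) = (vec_at 0 \<rho> :: (int, 'n) vec)"
      "vec_at CARD('n) (\<rho>(3 * CARD('n) := b)) = (vec_at CARD('n) \<rho> :: (int, 'n) vec)"
      by (auto intro!: vec_at_cong)
    then show "(0 < int_inner (vec_at 0 (\<rho>(3 * CARD('n) := b))) (scaled_diff (input_numerator m a)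
        (input_denominator m a) (vec_at CARD('n) (\<rho>(3 * CARD('n) := b)) :: (int, 'n) vec))) =
      (0 < int_inner (vec_at 0 \<rho>) (scaled_diff (input_numerator m a)
        (input_denominator m a) (vec_at CARD('n) \<rho> :: (int, 'n) vec)))" by simp
  qed (intro feasible_const feasible_load)+
  fix \<rho> \<rho>' :: "nat \<Rightarrow> int" and m e
  assume "\<And>i. i \<notin> {0..<0 + CARD('n)} \<Longrightarrow> \<rho> i = \<rho>' i"
  then have "(vec_at CARD('n) \<rho> :: (int, 'n) vec) = vec_at CARD('n) \<rho>'" by (intro vec_at_cong) auto
  then show "(\<forall>i\<in>{0..<m 0}. 0 < int_inner e (scaled_diff (input_numerator m i) (input_denominator m i)
      (vec_at CARD('n) \<rho> :: (int, 'n) vec))) = (\<forall>i\<in>{0..<m 0}. 0 < int_inner e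
      (scaled_diff (input_numerator m i) (input_denominator m i) (vec_at CARD('n) \<rho>')))" by simp
qed

text \<open>Register \<open>3 * CARD('n)\<close> holds the value \<open>v\<close> here and the index
  of a point inside \<open>separated\<close>. The clash is harmless, because besides the memory
  \<open>separated\<close> depends on the block of \<open>x\<close> only.\<close>

lemma feasible_count_values: "feasible (\<lambda>\<rho> m. count_values m (vec_at (2 * CARD('n)) \<rho>))"
  unfolding count_values_def
proof (rule feasible_sum_var[where v = "3 * CARD('n)"])
  show "feasible (\<lambda>\<rho> m. of_bool (\<exists>x. (\<forall>i. \<bar>x $ i\<bar> \<le> input_bound m) \<and> \<not> separated m x \<and>
      int_inner (vec_at (2 * CARD('n)) \<rho> :: (int, 'n) vec) x = \<rho> (3 * CARD('n))))"
    unfolding decidable_def[symmetric]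
  proof (rule decidable_Ex_vec[where b = "CARD('n)", OF feasible_input_bound])
    show "decidable (\<lambda>\<rho> m. \<not> separated m (vec_at CARD('n) \<rho>) \<and>
      int_inner (vec_at (2 * CARD('n)) \<rho> :: (int, 'n) vec) (vec_at CARD('n) \<rho>) = \<rho> (3 * CARD('n)))"
      by (intro decidable_conj decidable_not decidable_separated decidable_eq feasible_int_inner
          feasible_vec_at_nth feasible_reg)
    fix \<rho> \<rho>' :: "nat \<Rightarrow> int" and m x
    assume eq: "\<And>i. i \<notin> {CARD('n)..<CARD('n) + CARD('n)} \<Longrightarrow> \<rho> i = \<rho>' i"
    then have "(vec_at (2 * CARD('n)) \<rho> :: (int, 'n) vec) = vec_at (2 * CARD('n)) \<rho>'" by (intro vec_at_cong) auto
    then show "(\<not> separated m x \<and> int_inner (vec_at (2 * CARD('n)) \<rho> :: (int, 'n) vec) x = \<rho> (3 * CARD('n))) =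
      (\<not> separated m x \<and> int_inner (vec_at (2 * CARD('n)) \<rho>') x = \<rho>' (3 * CARD('n)))"
      using eq[of "3 * CARD('n)"] by simp
  qed
  fix \<rho> m a b
  have "vec_at (2 * CARD('n)) (\<rho>(3 * CARD('n) := b)) = (vec_at (2 * CARD('n)) \<rho> :: (int, 'n) vec)"
    by (auto intro!: vec_at_cong)
  then show "(of_bool (\<exists>x. (\<forall>i. \<bar>x $ i\<bar> \<le> input_bound m) \<and> \<not> separated m x \<and>
      int_inner (vec_at (2 * CARD('n)) (\<rho>(3 * CARD('n) := b)) :: (int, 'n) vec) x = a) :: int) =
    of_bool (\<exists>x. (\<forall>i. \<bar>x $ i\<bar> \<le> input_bound m) \<and> \<not> separated m x \<and>
      int_inner (vec_at (2 * CARD('n)) \<rho> :: (int, 'n) vec) x = a)" by simp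
qed (intro feasible_uminus feasible_add feasible_const feasible_value_bound)+

lemma feasible_width_search: "feasible (\<lambda>_. width_search)"
proof -
  \<comment> \<open>The search lemma \<open>decidable_Ex_vec\<close> is about existential
    quantifiers, and \<open>c \<noteq> 0\<close> has to become a test of finitely many
    coordinates.\<close>
  have not_Ex: "(\<forall>c :: (int, 'n) vec. (\<forall>i. \<bar>c $ i\<bar> \<le> R) \<longrightarrow> c \<noteq> 0 \<longrightarrow> Q c) \<longleftrightarrow>
    \<not> (\<exists>c. (\<forall>i. \<bar>c $ i\<bar> \<le> R) \<and> \<not> (\<forall>i\<in>UNIV. c $ i = 0) \<and> \<not> Q c)" for R Q
    by (auto simp: vec_eq_iff)
  show ?thesis
    unfolding width_search_def not_Ex
  proof (rule feasible_sum_var[where v = "3 * CARD('n)"])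
    show "feasible (\<lambda>\<rho> m. of_bool (\<not> (\<exists>c :: (int, 'n) vec. (\<forall>i. \<bar>c $ i\<bar> \<le> search_bound m) \<and>
        \<not> (\<forall>i\<in>UNIV. c $ i = 0) \<and> \<not> \<rho> (3 * CARD('n)) < count_values m c)))"
      unfolding decidable_def[symmetric]
    proof (rule decidable_not, rule decidable_Ex_vec[where b = "2 * CARD('n)", OF feasible_search_bound])
      show "decidable (\<lambda>\<rho> m. \<not> (\<forall>i\<in>UNIV. (vec_at (2 * CARD('n)) \<rho> :: (int, 'n) vec) $ i = 0) \<and>
          \<not> \<rho> (3 * CARD('n)) < count_values m (vec_at (2 * CARD('n)) \<rho>))"
        by (intro decidable_conj decidable_not decidable_less decidable_finite_Ball decidable_eq
            feasible_count_values feasible_vec_at_nth feasible_reg feasible_const finite)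
      fix \<rho> \<rho>' :: "nat \<Rightarrow> int" and m and c :: "(int, 'n) vec"
      assume eq: "\<And>i. i \<notin> {2 * CARD('n)..<2 * CARD('n) + CARD('n)} \<Longrightarrow> \<rho> i = \<rho>' i"
      show "(\<not> (\<forall>i\<in>UNIV. c $ i = 0) \<and> \<not> \<rho> (3 * CARD('n)) < count_values m c) =
        (\<not> (\<forall>i\<in>UNIV. c $ i = 0) \<and> \<not> \<rho>' (3 * CARD('n)) < count_values m c)"
        using eq[of "3 * CARD('n)"] by simp
    qed
  qed (intro feasible_mult feasible_add feasible_const feasible_value_bound refl)+
qed

lemma width_search_encode:
  fixes ps :: "(rat, 'n) vec list"
  assumes m: "m = snd (initial_state (encode ps))"
  shows "width_search m = int (aw (rat_polytope ps))"
proof -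
  let ?S = "input_bound m"
  have m0: "m 0 = int (length ps)"
    using initial_memory_nth[of 0 "encode ps"] by (simp add: m encode_def)
  have entry: "\<bar>m a\<bar> \<le> ?S" if "a \<in> {0..<1 + 2 * int CARD('n) * m 0}" for a
  proof -
    have "\<bar>m a\<bar> * 1 \<le> \<bar>m a\<bar> * \<bar>m a\<bar>"
    proof (cases "m a = 0")
      case False
      then show ?thesis by (intro mult_left_mono) auto
    qed simp
    then have "\<bar>m a\<bar> \<le> m a * m a" by simp
    also have "\<dots> \<le> (\<Sum>a\<in>{0..<1 + 2 * int CARD('n) * m 0}. m a * m a)"
      using that by (intro member_le_sum) auto
    finally show ?thesis by (simp add: input_bound_def)
  qed
  have S: "1 \<le> ?S" unfolding input_bound_def by (simp add: sum_nonneg)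
  have entries: "\<bar>input_numerator m (int i) j\<bar> \<le> ?S" "\<bar>input_denominator m (int i) j\<bar> \<le> ?S"
    if i: "i < length ps" for i and j :: 'n
  proof -
    \<comment> \<open>The denominator has the larger address; for the last coordinate of the last
      point it is the last cell of the input.\<close>
    have "2 * coord j + 2 < 1 + 2 * CARD('n)" using coord_less[of j] by linarith
    then have "2 * CARD('n) * i + (2 * coord j + 2) < 1 + 2 * CARD('n) * Suc i" by simp
    also have "\<dots> \<le> 1 + 2 * CARD('n) * length ps" using i by (intro add_left_mono mult_left_mono) auto
    finally have "int (2 * CARD('n) * i + (2 * coord j + 2)) < int (1 + 2 * CARD('n) * length ps)"
      by (simp only: of_nat_less_iff)
    then show "\<bar>input_numerator m (int i) j\<bar> \<le> ?S" "\<bar>input_denominator m (int i) j\<bar> \<le> ?S"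
      unfolding input_numerator_def input_denominator_def by (intro entry; simp add: m0)+
  qed
  have num: "\<bar>numerator (p $ j)\<bar> \<le> ?S" and den: "\<bar>denominator (p $ j)\<bar> \<le> ?S" if "p \<in> set ps" for p j
    using that entries input_entries[OF m] by (metis in_set_conv_nth)+
  have all_points: "(\<forall>i\<in>{0..<m 0}. 0 < int_inner e (scaled_diff (input_numerator m i) (input_denominator m i) x))
    \<longleftrightarrow> (\<forall>p\<in>set ps. 0 < int_inner e (point_diff p x))" for e x :: "(int, 'n) vec"
  proof -
    have "input_numerator m (int i) = (\<lambda>j. numerator (ps ! i $ j))"
      "input_denominator m (int i) = (\<lambda>j. denominator (ps ! i $ j))" if "i < length ps" for i
      using input_entries[OF m that] by auto
    moreover have "{0..<m 0} = int ` {..<length ps}"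
      unfolding m0 by (simp add: image_int_atLeastLessThan lessThan_atLeast0)
    ultimately show ?thesis by (auto simp: all_set_conv_all_nth)
  qed
  \<comment> \<open>Within the box the separation test decides membership; outside it both sides are
    false.\<close>
  have "(\<forall>i. \<bar>x $ i\<bar> \<le> ?S) \<and> \<not> separated m x \<and> Q \<longleftrightarrow> real_vec x \<in> rat_polytope ps \<and> Q"
    for x :: "(int, 'n) vec" and Q
  proof (cases "\<forall>i. \<bar>x $ i\<bar> \<le> ?S")
    case True
    then show ?thesis
      using not_in_rat_polytope_iff[where x = x, OF S num den _ search_bound_def]
      unfolding separated_def all_points by blast
  next
    case False
    then show ?thesis using rat_polytope_bound[OF num] by blast
  qed
  then have count: "count_values m c =
      (\<Sum>v\<in>{- value_bound m..<value_bound m + 1}. of_bool (\<exists>x. real_vec x \<in> rat_polytope ps \<and> int_inner c x = v))"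
    for c
    unfolding count_values_def by simp
  have "?S \<le> ?S ^ (CARD('n) + 1)" using power_increasing[of 1 "CARD('n) + 1" ?S] S by simp
  then have "2 * int CARD('n) * (2 * ?S) \<le> 2 * int (CARD('n) + 1) * (2 * ?S ^ (CARD('n) + 1))"
    using S by (intro mult_mono) auto
  then have R: "(2 * int CARD('n) * (2 * ?S) + 1) ^ CARD('n) \<le> search_bound m"
    unfolding search_bound_def using S by (intro power_mono) auto
  have "0 \<le> ?S" using S by simp
  then show ?thesis
    unfolding width_search_def count
    by (rule aw_bounded_search[OF _ rat_polytope_bound R value_bound_def]) (rule num)
qed

end

theorem theorem5p5:
  "\<exists>(p :: com) (C :: nat). computes_in_time p
     (encode :: (rat ^ 'n::{finite,linorder}) list \<Rightarrow> int list)
     (\<lambda>ps. int (aw (rat_polytope ps)))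
     (\<lambda>ps. 2 ^ (C * bit_size ps))"
proof -
  obtain p K where p: "\<And>m B. 2 \<le> B \<Longrightarrow> (\<And>a. nat \<bar>m a\<bar> \<le> B) \<Longrightarrow>
    \<exists>\<rho>. runs p (\<lambda>_. 0, m) (B ^ K) (\<rho>, m) \<and> \<rho> 0 = width_search TYPE('n) m"
    using feasible_computable[OF feasible_width_search[where 'n = 'n]] by blast
  have "\<exists>t s. exec p (initial_state (encode ps)) t s \<and> fst s 0 = int (aw (rat_polytope ps)) \<and>
    t \<le> 2 ^ (K * bit_size ps)" for ps :: "(rat, 'n) vec list"
  proof -
    let ?m = "snd (initial_state (encode ps))"
    \<comment> \<open>\<open>B = 2 ^ L\<close> has to be at least \<open>2\<close>, which holds
      since already the encoded number of points has a sign bit. Then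
      \<open>B ^ K = 2 ^ (K * L)\<close>, so \<open>C = K\<close> works.\<close>
    have "(2 :: nat) ^ 1 \<le> 2 ^ bit_size ps" by (rule power_increasing[OF bit_size_pos]) simp
    then have "(2 :: nat) \<le> 2 ^ bit_size ps" by simp
    from p[of _ ?m, OF this input_le_bit_size] obtain \<rho>
      where "runs p (\<lambda>_. 0, ?m) ((2 ^ bit_size ps) ^ K) (\<rho>, ?m)" "\<rho> 0 = width_search TYPE('n) ?m" by blast
    moreover have "(\<lambda>_. 0, ?m) = initial_state (encode ps)" by (simp add: initial_state_def)
    ultimately show ?thesis
      using width_search_encode[of ?m ps] unfolding runs_def
      by (auto simp: power_mult[symmetric] mult.commute)
  qed
  then show ?thesis unfolding computes_in_time_def by blast
qed

end
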